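(* The map $P_\omega:\widehat{\mathfrak I}\to\mathbb{Z}$ is surjective and is not in the span of the maps $\{\phi_n\}_{n\ge 1}$.
   Context: Let $\mathbb{F}=\mathbb{F}_2$. An almost $\iota$-complex $\mathcal{C}=(C,\partial,\bar\iota)$ consists of a free, finitely generated, $\mathbb{Z}$-graded chain complex $(C,\partial)$ over $\mathbb{F}[U]$ ($\deg U=-2$, $\deg\partial=-1$) with $U^{-1}H_*(C)\cong\mathbb{F}[U,U^{-1}]$ supported in even gradings, together with a grading-preserving $\mathbb{F}[U]$-module homomorphism $\bar\iota:C\to C$ with $\bar\iota\partial+\partial\bar\iota\in \mathrm{im}\,U$ and $\bar\iota^2\simeq\mathrm{id}\mod U$. Here two grading-preserving $\mathbb{F}[U]$-module maps $f,g:C\to C'$ are homotopic mod $U$, written $f\simeq g\mod U$, if there is an $\mathbb{F}[U]$-module map $H:C\to C'$ raising grading by one with $f+g+H\partial+\partial H\in\mathrm{im}\,U$. Put $\omega=1+\bar\iota$. Two almost $\iota$-complexes $(C,\partial,\bar\iota)$, $(C',\partial',\bar\iota')$ are locally equivalent if there are grading-preserving $\mathbb{F}[U]$-equivariant chain maps $f:C\to C'$, $g:C'\to C$ with $f\bar\iota\simeq\bar\iota' f\mod U$, $g\bar\iota'\simeq\bar\iota g\mod U$, inducing isomorphisms between $U^{-1}H_*(C)$ and $U^{-1}H_*(C')$. The set $\widehat{\mathfrak I}$ of local equivalence classes is an abelian group under tensor product, $(C_1,\bar\iota_1)*(C_2,\bar\iota_2)=(C_1\otimes_{\mathbb{F}[U]}C_2,\bar\iota_1\otimes\bar\iota_2)$.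 For $n\ge 0$, $a_i\in\{-,+\}$ ($i$ odd) and $b_i\in\mathbb{Z}\setminus\{0\}$ ($i$ even), the standard complex $\mathcal{C}(a_1,b_2,\dots,a_{2n-1},b_{2n})$ is the almost $\iota$-complex freely generated over $\mathbb{F}[U]$ by $T_0,\dots,T_{2n}$ with $\partial T_{2i}=U^{|b_{2i}|}T_{2i-1}$ if $b_{2i}>0$, $\partial T_{2i-1}=U^{|b_{2i}|}T_{2i}$ if $b_{2i}<0$, $\omega T_i=T_{i-1}$ if $a_i=+$, $\omega T_{i-1}=T_i$ if $a_i=-$, and $\partial$, $\omega$ zero on generators where not specified; $T_0$ is normalized to have grading $0$. It is a known theorem (Dai–Hom–Stoffregen–Truong) that every almost $\iota$-complex is locally equivalent, up to an overall even grading shift, to a unique standard complex, called its standard complex representative. For a class in $\widehat{\mathfrak I}$ with standard complex representative $\mathcal{C}(a_1,b_2,\dots,a_{2n-1},b_{2n})$, define $P_\omega=\#\{i: a_i=+\}-\#\{i: a_i=-\}$ and, for each integer $m\ge1$, $\phi_m=\#\{i: b_i=m\}-\#\{i: b_i=-m\}$. *)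

theory Defs
  imports
    "Jordan_Normal_Form.Matrix"
    "HOL-Computational_Algebra.Polynomial"
    "HOL-Library.Z2"
    "HOL-Library.Poly_Mapping"
    "HOL-Library.Function_Algebras"
begin

section \<open>Finitely generated free graded modules over \<open>\<bbbF>[U]\<close>\<close>

text \<open>
  The ring \<open>\<bbbF>[U]\<close>, with \<open>\<bbbF>\<close> the field of two elements, is the type \<^typ>\<open>bit poly\<close>.
  A finitely generated free graded module is given by the list of the degrees of a homogeneous
  basis; its elements are coordinate vectors, and homomorphisms are matrices acting on
  columns. The data of an almost \<open>\<iota>\<close>-complex are such a module with two endomorphisms,
  the differential and the almost involution.
\<close>

definition Uvar :: "bit poly" where
  "Uvar = monom 1 1"

datatype iota_data =
  IotaData (gr: "int list") (bdry: "bit poly mat") (inv\<iota>: "bit poly mat")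

definition rank :: "iota_data \<Rightarrow> nat" where
  "rank C = length (gr C)"

text \<open>Homogeneous elements: \<open>U\<^sup>k\<close> times the \<open>i\<close>-th generator has degree \<open>gr C ! i - 2k\<close>.\<close>

definition homogeneous :: "iota_data \<Rightarrow> int \<Rightarrow> bit poly vec set" where
  "homogeneous C d = {v \<in> carrier_vec (rank C).
     \<forall>i<rank C. \<forall>k. coeff (v $ i) k \<noteq> 0 \<longrightarrow> gr C ! i - 2 * int k = d}"

definition module_maps :: "iota_data \<Rightarrow> iota_data \<Rightarrow> bit poly mat set" where
  "module_maps C D = carrier_mat (rank D) (rank C)"

definition graded_maps :: "iota_data \<Rightarrow> iota_data \<Rightarrow> int \<Rightarrow> bit poly mat set" where
  "graded_maps C D r =
     {f \<in> module_maps C D. \<forall>d. \<forall>v \<in> homogeneous C d. f *\<^sub>v v \<in> homogeneous D (d + r)}"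

definition im_U :: "iota_data \<Rightarrow> iota_data \<Rightarrow> bit poly mat set" where
  "im_U C D = {Uvar \<cdot>\<^sub>m X | X. X \<in> module_maps C D}"

definition homotopic_mod_U ::
    "iota_data \<Rightarrow> iota_data \<Rightarrow> bit poly mat \<Rightarrow> bit poly mat \<Rightarrow> bool" where
  "homotopic_mod_U C D f g \<longleftrightarrow>
     (\<exists>H \<in> graded_maps C D 1. f + g + H * bdry C + bdry D * H \<in> im_U C D)"


section \<open>Localized homology\<close>

definition cycles :: "iota_data \<Rightarrow> bit poly vec set" where
  "cycles C = {x \<in> carrier_vec (rank C). bdry C *\<^sub>v x = 0\<^sub>v (rank C)}"

definition boundaries :: "iota_data \<Rightarrow> bit poly vec set" where
  "boundaries C = {bdry C *\<^sub>v y | y. y \<in> carrier_vec (rank C)}"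

text \<open>
  An element of \<open>U\<^sup>-\<^sup>1H\<^sub>*(C)\<close> is a class \<open>[x]/U\<^sup>k\<close> of pairs \<open>(x, k)\<close> of a cycle \<open>x\<close> and an exponent
  \<open>k\<close>; we have \<open>[x]/U\<^sup>k = [y]/U\<^sup>l\<close> iff \<open>U\<^sup>m(U\<^sup>l x - U\<^sup>k y)\<close> is a boundary for some \<open>m\<close>.
\<close>

definition loc_rel :: "iota_data \<Rightarrow> ((bit poly vec \<times> nat) \<times> (bit poly vec \<times> nat)) set" where
  "loc_rel C = {((x, k), (y, l)). x \<in> cycles C \<and> y \<in> cycles C \<and>
     (\<exists>m. Uvar ^ m \<cdot>\<^sub>v (Uvar ^ l \<cdot>\<^sub>v x - Uvar ^ k \<cdot>\<^sub>v y) \<in> boundaries C)}"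

definition loc_homology :: "iota_data \<Rightarrow> (bit poly vec \<times> nat) set set" where
  "loc_homology C = (cycles C \<times> UNIV) // loc_rel C"

definition loc_frac :: "iota_data \<Rightarrow> bit poly vec \<Rightarrow> nat \<Rightarrow> (bit poly vec \<times> nat) set" where
  "loc_frac C x k = loc_rel C `` {(x, k)}"

definition loc_map ::
    "iota_data \<Rightarrow> bit poly mat \<Rightarrow> (bit poly vec \<times> nat) set \<Rightarrow> (bit poly vec \<times> nat) set" where
  "loc_map D f X = (\<Union>(x, k) \<in> X. loc_frac D (f *\<^sub>v x) k)"

text \<open>
  \<open>\<bbbF>[U,U\<^sup>-\<^sup>1]\<close> is the monoid algebra \<^typ>\<open>int \<Rightarrow>\<^sub>0 bit\<close>, graded by \<open>deg U = -2\<close>; with this grading it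
  is supported in even degrees. Over the field of two elements, an additive map commuting with
  \<open>U\<close> is \<open>\<bbbF>[U]\<close>-linear.
\<close>

definition laurent_homogeneous :: "int \<Rightarrow> (int \<Rightarrow>\<^sub>0 bit) set" where
  "laurent_homogeneous d = {p. \<forall>j \<in> Poly_Mapping.keys p. - 2 * j = d}"

definition loc_homology_is_laurent :: "iota_data \<Rightarrow> bool" where
  "loc_homology_is_laurent C \<longleftrightarrow> (\<exists>\<Phi> :: (bit poly vec \<times> nat) set \<Rightarrow> (int \<Rightarrow>\<^sub>0 bit).
     bij_betw \<Phi> (loc_homology C) UNIV \<and>
     (\<forall>x \<in> cycles C. \<forall>y \<in> cycles C. \<forall>k l.
        \<Phi> (loc_frac C (Uvar ^ l \<cdot>\<^sub>v x + Uvar ^ k \<cdot>\<^sub>v y) (k + l))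
          = \<Phi> (loc_frac C x k) + \<Phi> (loc_frac C y l)) \<and>
     (\<forall>x \<in> cycles C. \<forall>k.
        \<Phi> (loc_frac C (Uvar \<cdot>\<^sub>v x) k) = Poly_Mapping.single 1 1 * \<Phi> (loc_frac C x k)) \<and>
     (\<forall>d. \<forall>x \<in> cycles C \<inter> homogeneous C d. \<forall>k.
        \<Phi> (loc_frac C x k) \<in> laurent_homogeneous (d + 2 * int k)))"


section \<open>Almost \<open>\<iota>\<close>-complexes and local equivalence\<close>

definition almost_iota_complex :: "iota_data \<Rightarrow> bool" where
  "almost_iota_complex C \<longleftrightarrow>
     bdry C \<in> graded_maps C C (-1) \<and>
     bdry C * bdry C = 0\<^sub>m (rank C) (rank C) \<and>
     loc_homology_is_laurent C \<and>
     inv\<iota> C \<in> graded_maps C C 0 \<and>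
     inv\<iota> C * bdry C + bdry C * inv\<iota> C \<in> im_U C C \<and>
     homotopic_mod_U C C (inv\<iota> C * inv\<iota> C) (1\<^sub>m (rank C))"

definition local_map :: "iota_data \<Rightarrow> iota_data \<Rightarrow> bit poly mat \<Rightarrow> bool" where
  "local_map C D f \<longleftrightarrow>
     f \<in> graded_maps C D 0 \<and>
     f * bdry C = bdry D * f \<and>
     homotopic_mod_U C D (f * inv\<iota> C) (inv\<iota> D * f) \<and>
     bij_betw (loc_map D f) (loc_homology C) (loc_homology D)"

definition locally_equivalent :: "iota_data \<Rightarrow> iota_data \<Rightarrow> bool" where
  "locally_equivalent C D \<longleftrightarrow> (\<exists>f. local_map C D f) \<and> (\<exists>g. local_map D C g)"


section \<open>Local equivalence is a partial equivalence relation\<close>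

definition iota_equiv :: "iota_data \<Rightarrow> iota_data \<Rightarrow> bool" where
  "iota_equiv C D \<longleftrightarrow>
     almost_iota_complex C \<and> almost_iota_complex D \<and> locally_equivalent C D"

lemma bit_poly_add_self: "p + p = (0 :: bit poly)"
proof (rule poly_eqI)
  fix n
  have "a + a = 0" for a :: bit by (cases a) auto
  then show "coeff (p + p) n = coeff 0 n" by (simp only: coeff_add coeff_0)
qed

lemma bit_poly_two: "(2 :: bit poly) = 0"
  using bit_poly_add_self[of 1] by (simp only: one_add_one)

lemma homogeneous_carrier: "v \<in> homogeneous C d \<Longrightarrow> v \<in> carrier_vec (rank C)"
  by (simp add: homogeneous_def)

lemma homogeneous_add:
  assumes "v \<in> homogeneous C d" "w \<in> homogeneous C d"
  shows "v + w \<in> homogeneous C d"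
proof -
  have "coeff (v $ i) k \<noteq> 0 \<or> coeff (w $ i) k \<noteq> 0"
    if "coeff ((v + w) $ i) k \<noteq> 0" "i < rank C" for i k
    using that assms(2) unfolding homogeneous_def carrier_vec_def by auto
  then show ?thesis using assms unfolding homogeneous_def by (auto; blast)
qed

lemma graded_mapsD:
  "f \<in> graded_maps C D r \<Longrightarrow> f \<in> carrier_mat (rank D) (rank C)"
  by (simp add: graded_maps_def module_maps_def)

lemma graded_maps_add:
  assumes "f \<in> graded_maps C D r" "g \<in> graded_maps C D r"
  shows "f + g \<in> graded_maps C D r"
  unfolding graded_maps_def module_maps_def
proof (intro CollectI conjI allI ballI)
  note c = assms[THEN graded_mapsD]
  show "f + g \<in> carrier_mat (rank D) (rank C)" using c by auto
  fix d v assume v: "v \<in> homogeneous C d"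
  have "(f + g) *\<^sub>v v = f *\<^sub>v v + g *\<^sub>v v"
    using c homogeneous_carrier[OF v] by (rule add_mult_distrib_mat_vec)
  then show "(f + g) *\<^sub>v v \<in> homogeneous D (d + r)"
    using assms v homogeneous_add unfolding graded_maps_def by auto
qed

lemma graded_maps_mult:
  assumes "f \<in> graded_maps C D r" "g \<in> graded_maps D E s"
  shows "g * f \<in> graded_maps C E (r + s)"
  unfolding graded_maps_def module_maps_def
proof (intro CollectI conjI allI ballI)
  note c = assms[THEN graded_mapsD]
  show "g * f \<in> carrier_mat (rank E) (rank C)" using c by auto
  fix d v assume v: "v \<in> homogeneous C d"
  have "(g * f) *\<^sub>v v = g *\<^sub>v (f *\<^sub>v v)"
    using c homogeneous_carrier[OF v] by (intro assoc_mult_mat_vec) auto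
  moreover have "g *\<^sub>v (f *\<^sub>v v) \<in> homogeneous E ((d + r) + s)"
    using assms v unfolding graded_maps_def by blast
  ultimately show "(g * f) *\<^sub>v v \<in> homogeneous E (d + (r + s))"
    by (simp add: add.assoc)
qed

lemma homotopic_mod_U_comp:
  assumes C: "bdry C \<in> graded_maps C C (-1)" "inv\<iota> C \<in> graded_maps C C 0"
    and D: "bdry D \<in> graded_maps D D (-1)" "inv\<iota> D \<in> graded_maps D D 0"
    and E: "bdry E \<in> graded_maps E E (-1)" "inv\<iota> E \<in> graded_maps E E 0"
    and f: "f \<in> graded_maps C D 0" "f * bdry C = bdry D * f"
      "homotopic_mod_U C D (f * inv\<iota> C) (inv\<iota> D * f)"
    and g: "g \<in> graded_maps D E 0" "g * bdry D = bdry E * g"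
      "homotopic_mod_U D E (g * inv\<iota> D) (inv\<iota> E * g)"
  shows "homotopic_mod_U C E (g * f * inv\<iota> C) (inv\<iota> E * (g * f))"
proof -
  let ?c = "rank C" let ?d = "rank D" let ?e = "rank E"
  let ?dC = "bdry C" let ?dD = "bdry D" let ?dE = "bdry E"
  let ?iC = "inv\<iota> C" let ?iD = "inv\<iota> D" let ?iE = "inv\<iota> E"
  obtain H X where H: "H \<in> graded_maps C D 1" and X: "X \<in> carrier_mat ?d ?c"
    and eqH: "f * ?iC + ?iD * f + H * ?dC + ?dD * H = Uvar \<cdot>\<^sub>m X"
    using f(3) unfolding homotopic_mod_U_def im_U_def module_maps_def by auto
  obtain K Y where K: "K \<in> graded_maps D E 1" and Y: "Y \<in> carrier_mat ?e ?d"
    and eqK: "g * ?iD + ?iE * g + K * ?dD + ?dE * K = Uvar \<cdot>\<^sub>m Y"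
    using g(3) unfolding homotopic_mod_U_def im_U_def module_maps_def by auto
  note c = C[THEN graded_mapsD] D[THEN graded_mapsD] E[THEN graded_mapsD]
    f(1)[THEN graded_mapsD] g(1)[THEN graded_mapsD] H[THEN graded_mapsD] K[THEN graded_mapsD]
  let ?L = "g * H + K * f"
  have L: "?L \<in> graded_maps C E 1"
    using graded_maps_mult[OF H g(1)] graded_maps_mult[OF f(1) K] graded_maps_add by simp
  have gX: "g * (f * ?iC) + g * (?iD * f) + g * (H * ?dC) + g * (?dD * H) = Uvar \<cdot>\<^sub>m (g * X)"
  proof -
    have "Uvar \<cdot>\<^sub>m (g * X) = g * (f * ?iC + ?iD * f + H * ?dC + ?dD * H)"
      using c X by (simp add: eqH mult_smult_distrib)
    also have "\<dots> = g * (f * ?iC) + g * (?iD * f) + g * (H * ?dC) + g * (?dD * H)"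
      using c by (simp add: mult_add_distrib_mat[where nr = ?e and n = ?d and nc = ?c])
    finally show ?thesis by simp
  qed
  have Yf: "g * ?iD * f + ?iE * g * f + K * ?dD * f + ?dE * K * f = Uvar \<cdot>\<^sub>m (Y * f)"
  proof -
    have "Uvar \<cdot>\<^sub>m (Y * f) = (g * ?iD + ?iE * g + K * ?dD + ?dE * K) * f"
      using c Y by (simp add: eqK mult_smult_assoc_mat)
    also have "\<dots> = g * ?iD * f + ?iE * g * f + K * ?dD * f + ?dE * K * f"
      using c by (simp add: add_mult_distrib_mat[where nr = ?e and n = ?d and nc = ?c])
    finally show ?thesis by simp
  qed
  have a1: "g * (f * ?iC) = g * f * ?iC" using c by (simp add: assoc_mult_mat[of _ ?e ?d _ ?c _ ?c])
  have a2: "g * ?iD * f = g * (?iD * f)" using c by (simp add: assoc_mult_mat[of _ ?e ?d _ ?d _ ?c])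
  have a3: "g * (H * ?dC) = g * H * ?dC" using c by (simp add: assoc_mult_mat[of _ ?e ?d _ ?c _ ?c])
  have a4: "g * (?dD * H) = ?dE * (g * H)"
  proof -
    have "g * (?dD * H) = (g * ?dD) * H" using c by (simp add: assoc_mult_mat[of _ ?e ?d _ ?d _ ?c])
    also have "\<dots> = ?dE * (g * H)" using c unfolding g(2)
      by (simp add: assoc_mult_mat[of _ ?e ?e _ ?d _ ?c])
    finally show ?thesis .
  qed
  have a5: "?iE * g * f = ?iE * (g * f)" using c by (simp add: assoc_mult_mat[of _ ?e ?e _ ?d _ ?c])
  have a6: "K * ?dD * f = K * f * ?dC"
  proof -
    have "K * ?dD * f = K * (?dD * f)" using c by (simp add: assoc_mult_mat[of _ ?e ?d _ ?d _ ?c])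
    also have "\<dots> = K * f * ?dC" using c unfolding f(2)[symmetric]
      by (simp add: assoc_mult_mat[of _ ?e ?d _ ?c _ ?c])
    finally show ?thesis .
  qed
  have a7: "?dE * K * f = ?dE * (K * f)" using c by (simp add: assoc_mult_mat[of _ ?e ?e _ ?d _ ?c])
  have l1: "?L * ?dC = g * H * ?dC + K * f * ?dC"
    using c by (simp add: add_mult_distrib_mat[where nr = ?e and n = ?c and nc = ?c])
  have l2: "?dE * ?L = ?dE * (g * H) + ?dE * (K * f)"
    using c by (simp add: mult_add_distrib_mat[where nr = ?e and n = ?e and nc = ?c])
  have sum4: "A + B + (P + Q) + (R + S) = (A + M + P + R) + (M + B + Q + S)"
    if "A \<in> carrier_mat ?e ?c" "B \<in> carrier_mat ?e ?c" "M \<in> carrier_mat ?e ?c"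
       "P \<in> carrier_mat ?e ?c" "Q \<in> carrier_mat ?e ?c" "R \<in> carrier_mat ?e ?c"
       "S \<in> carrier_mat ?e ?c" for A B M P Q R S :: "bit poly mat"
    using that by (intro eq_matI) (auto simp: bit_poly_two)
  have "g * f * ?iC + ?iE * (g * f) + ?L * ?dC + ?dE * ?L = Uvar \<cdot>\<^sub>m (g * X) + Uvar \<cdot>\<^sub>m (Y * f)"
    unfolding l1 l2 gX[symmetric] Yf[symmetric] a1 a2 a3 a4 a5 a6 a7
    using c by (intro sum4) auto
  also have "\<dots> = Uvar \<cdot>\<^sub>m (g * X + Y * f)"
    using c X Y by (intro add_smult_distrib_left_mat[symmetric, of _ ?e ?c]) auto
  finally show ?thesis
    unfolding homotopic_mod_U_def im_U_def module_maps_def using c X Y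
    by (intro bexI[OF _ L] CollectI exI[of _ "g * X + Y * f"]) auto
qed

lemma cyclesD: "x \<in> cycles C \<Longrightarrow> x \<in> carrier_vec (rank C)"
  by (simp add: cycles_def)

lemma mult_mat_smult_vec:
  fixes A :: "'a :: comm_ring_1 mat"
  assumes "A \<in> carrier_mat nr nc" "v \<in> carrier_vec nc"
  shows "A *\<^sub>v (k \<cdot>\<^sub>v v) = k \<cdot>\<^sub>v (A *\<^sub>v v)"
  using assms by (intro eq_vecI) auto

lemma boundaries_lincomb:
  assumes "bdry C \<in> carrier_mat (rank C) (rank C)" "u \<in> boundaries C" "w \<in> boundaries C"
  shows "a \<cdot>\<^sub>v u + b \<cdot>\<^sub>v w \<in> boundaries C"
proof -
  from assms(2,3) obtain x y where x: "x \<in> carrier_vec (rank C)" "u = bdry C *\<^sub>v x"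
    and y: "y \<in> carrier_vec (rank C)" "w = bdry C *\<^sub>v y" unfolding boundaries_def by auto
  have "bdry C *\<^sub>v (a \<cdot>\<^sub>v x + b \<cdot>\<^sub>v y) = bdry C *\<^sub>v (a \<cdot>\<^sub>v x) + bdry C *\<^sub>v (b \<cdot>\<^sub>v y)"
    using assms(1) x y by (intro mult_add_distrib_mat_vec) auto
  also have "\<dots> = a \<cdot>\<^sub>v u + b \<cdot>\<^sub>v w"
    unfolding x(2) y(2) using mult_mat_smult_vec[OF assms(1)] x(1) y(1) by simp
  finally have "a \<cdot>\<^sub>v u + b \<cdot>\<^sub>v w = bdry C *\<^sub>v (a \<cdot>\<^sub>v x + b \<cdot>\<^sub>v y)" by simp
  then show ?thesis unfolding boundaries_def using x y by auto
qed

lemma boundaries_carrier: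
  "bdry C \<in> carrier_mat (rank C) (rank C) \<Longrightarrow> boundaries C \<subseteq> carrier_vec (rank C)"
  unfolding boundaries_def by auto

lemma zero_boundary:
  "bdry C \<in> carrier_mat (rank C) (rank C) \<Longrightarrow> 0\<^sub>v (rank C) \<in> boundaries C"
  unfolding boundaries_def by (auto intro!: exI[of _ "0\<^sub>v (rank C)"])

lemma vec_sym_eq:
  fixes u :: "'a :: comm_ring_1"
  assumes "x \<in> carrier_vec n" "y \<in> carrier_vec n"
  shows "u ^ m \<cdot>\<^sub>v (u ^ k \<cdot>\<^sub>v y - u ^ l \<cdot>\<^sub>v x) =
    (- 1) \<cdot>\<^sub>v (u ^ m \<cdot>\<^sub>v (u ^ l \<cdot>\<^sub>v x - u ^ k \<cdot>\<^sub>v y)) + 0 \<cdot>\<^sub>v 0\<^sub>v n"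
  using assms by (intro eq_vecI) (auto simp: algebra_simps)

lemma vec_trans_eq:
  fixes u :: "'a :: comm_ring_1"
  assumes "x \<in> carrier_vec n" "y \<in> carrier_vec n" "z \<in> carrier_vec n"
  shows "u ^ (m + m' + l) \<cdot>\<^sub>v (u ^ j \<cdot>\<^sub>v x - u ^ k \<cdot>\<^sub>v z) =
    u ^ (m' + j) \<cdot>\<^sub>v (u ^ m \<cdot>\<^sub>v (u ^ l \<cdot>\<^sub>v x - u ^ k \<cdot>\<^sub>v y))
    + u ^ (m + k) \<cdot>\<^sub>v (u ^ m' \<cdot>\<^sub>v (u ^ j \<cdot>\<^sub>v y - u ^ l \<cdot>\<^sub>v z))"
  using assms by (intro eq_vecI) (auto simp: algebra_simps power_add)

lemma equiv_loc_rel: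
  assumes "bdry C \<in> carrier_mat (rank C) (rank C)"
  shows "equiv (cycles C \<times> UNIV) (loc_rel C)"
proof (rule equivI)
  show "loc_rel C \<subseteq> (cycles C \<times> UNIV) \<times> (cycles C \<times> UNIV)"
    by (auto simp: loc_rel_def)
  show "refl_on (cycles C \<times> UNIV) (loc_rel C)"
  proof (rule refl_onI)
    fix p assume "p \<in> cycles C \<times> (UNIV :: nat set)"
    then obtain x k where p: "p = (x, k)" "x \<in> cycles C" by auto
    have "Uvar ^ 0 \<cdot>\<^sub>v (Uvar ^ k \<cdot>\<^sub>v x - Uvar ^ k \<cdot>\<^sub>v x) = 0\<^sub>v (rank C)"
      using cyclesD[OF p(2)] by auto
    then have "\<exists>m. Uvar ^ m \<cdot>\<^sub>v (Uvar ^ k \<cdot>\<^sub>v x - Uvar ^ k \<cdot>\<^sub>v x) \<in> boundaries C"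
      using zero_boundary[OF assms] by metis
    then show "(p, p) \<in> loc_rel C" using p by (auto simp: loc_rel_def)
  qed
  show "sym (loc_rel C)"
  proof (rule symI)
    fix p q assume pq: "(p, q) \<in> loc_rel C"
    obtain x k y l where e: "p = (x, k)" "q = (y, l)" by fastforce
    obtain m where xy: "x \<in> cycles C" "y \<in> cycles C"
      and m: "Uvar ^ m \<cdot>\<^sub>v (Uvar ^ l \<cdot>\<^sub>v x - Uvar ^ k \<cdot>\<^sub>v y) \<in> boundaries C"
      using pq e by (auto simp: loc_rel_def)
    have "Uvar ^ m \<cdot>\<^sub>v (Uvar ^ k \<cdot>\<^sub>v y - Uvar ^ l \<cdot>\<^sub>v x) =
        (- 1) \<cdot>\<^sub>v (Uvar ^ m \<cdot>\<^sub>v (Uvar ^ l \<cdot>\<^sub>v x - Uvar ^ k \<cdot>\<^sub>v y)) + 0 \<cdot>\<^sub>v 0\<^sub>v (rank C)"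
      using xy[THEN cyclesD] by (intro vec_sym_eq)
    also have "\<dots> \<in> boundaries C"
      by (rule boundaries_lincomb[OF assms m zero_boundary[OF assms]])
    finally show "(q, p) \<in> loc_rel C" using xy e by (auto simp: loc_rel_def)
  qed
  show "trans (loc_rel C)"
  proof (rule transI)
    fix p q r assume pq: "(p, q) \<in> loc_rel C" and qr: "(q, r) \<in> loc_rel C"
    obtain x k y l z j where e: "p = (x, k)" "q = (y, l)" "r = (z, j)"
      by (metis surj_pair)
    obtain m m' where xyz: "x \<in> cycles C" "y \<in> cycles C" "z \<in> cycles C"
      and m: "Uvar ^ m \<cdot>\<^sub>v (Uvar ^ l \<cdot>\<^sub>v x - Uvar ^ k \<cdot>\<^sub>v y) \<in> boundaries C"
      and m': "Uvar ^ m' \<cdot>\<^sub>v (Uvar ^ j \<cdot>\<^sub>v y - Uvar ^ l \<cdot>\<^sub>v z) \<in> boundaries C"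
      using pq qr e by (auto simp: loc_rel_def)
    have "Uvar ^ (m + m' + l) \<cdot>\<^sub>v (Uvar ^ j \<cdot>\<^sub>v x - Uvar ^ k \<cdot>\<^sub>v z) =
        Uvar ^ (m' + j) \<cdot>\<^sub>v (Uvar ^ m \<cdot>\<^sub>v (Uvar ^ l \<cdot>\<^sub>v x - Uvar ^ k \<cdot>\<^sub>v y))
        + Uvar ^ (m + k) \<cdot>\<^sub>v (Uvar ^ m' \<cdot>\<^sub>v (Uvar ^ j \<cdot>\<^sub>v y - Uvar ^ l \<cdot>\<^sub>v z))"
      using xyz[THEN cyclesD] by (intro vec_trans_eq)
    also have "\<dots> \<in> boundaries C" by (rule boundaries_lincomb[OF assms m m'])
    finally show "(p, r) \<in> loc_rel C" using xyz e by (auto simp: loc_rel_def)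
  qed
qed

lemma chain_map_apply:
  assumes "bdry C \<in> carrier_mat (rank C) (rank C)" "bdry D \<in> carrier_mat (rank D) (rank D)"
    and "f \<in> carrier_mat (rank D) (rank C)" "f * bdry C = bdry D * f" "y \<in> carrier_vec (rank C)"
  shows "f *\<^sub>v (bdry C *\<^sub>v y) = bdry D *\<^sub>v (f *\<^sub>v y)"
proof -
  have "f *\<^sub>v (bdry C *\<^sub>v y) = (f * bdry C) *\<^sub>v y"
    by (rule assoc_mult_mat_vec[symmetric, OF assms(3,1,5)])
  also have "\<dots> = (bdry D * f) *\<^sub>v y" by (simp only: assms(4))
  also have "\<dots> = bdry D *\<^sub>v (f *\<^sub>v y)" by (rule assoc_mult_mat_vec[OF assms(2,3,5)])
  finally show ?thesis .
qed

lemma chain_map_cycle: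
  assumes "bdry C \<in> carrier_mat (rank C) (rank C)" "bdry D \<in> carrier_mat (rank D) (rank D)"
    and "f \<in> carrier_mat (rank D) (rank C)" "f * bdry C = bdry D * f" "x \<in> cycles C"
  shows "f *\<^sub>v x \<in> cycles D"
proof -
  have x: "x \<in> carrier_vec (rank C)" "bdry C *\<^sub>v x = 0\<^sub>v (rank C)"
    using assms(5) by (auto simp: cycles_def)
  have "bdry D *\<^sub>v (f *\<^sub>v x) = f *\<^sub>v (bdry C *\<^sub>v x)"
    using chain_map_apply[OF assms(1-4) x(1)] by simp
  also have "\<dots> = 0\<^sub>v (rank D)" using assms(3) by (auto simp: x(2))
  finally show ?thesis using assms(3) x(1) by (auto simp: cycles_def)
qed

lemma chain_map_boundary:
  assumes "bdry C \<in> carrier_mat (rank C) (rank C)" "bdry D \<in> carrier_mat (rank D) (rank D)"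
    and "f \<in> carrier_mat (rank D) (rank C)" "f * bdry C = bdry D * f" "x \<in> boundaries C"
  shows "f *\<^sub>v x \<in> boundaries D"
proof -
  obtain y where y: "y \<in> carrier_vec (rank C)" "x = bdry C *\<^sub>v y"
    using assms(5) by (auto simp: boundaries_def)
  have "f *\<^sub>v x = bdry D *\<^sub>v (f *\<^sub>v y)"
    unfolding y(2) by (rule chain_map_apply[OF assms(1-4) y(1)])
  then show ?thesis using mult_mat_vec_carrier[OF assms(3) y(1)] by (auto simp: boundaries_def)
qed

lemma loc_map_frac:
  assumes "bdry C \<in> carrier_mat (rank C) (rank C)" "bdry D \<in> carrier_mat (rank D) (rank D)"
    and "f \<in> carrier_mat (rank D) (rank C)" "f * bdry C = bdry D * f" "x \<in> cycles C"
  shows "loc_map D f (loc_frac C x k) = loc_frac D (f *\<^sub>v x) k"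
proof -
  have eq: "loc_frac D (f *\<^sub>v y) l = loc_frac D (f *\<^sub>v x) k" if yl: "(y, l) \<in> loc_frac C x k" for y l
  proof -
    obtain m where y: "y \<in> cycles C"
      and m: "Uvar ^ m \<cdot>\<^sub>v (Uvar ^ l \<cdot>\<^sub>v x - Uvar ^ k \<cdot>\<^sub>v y) \<in> boundaries C"
      using yl by (auto simp: loc_rel_def loc_frac_def)
    note c = cyclesD[OF y] cyclesD[OF assms(5)]
    have "Uvar ^ m \<cdot>\<^sub>v (Uvar ^ l \<cdot>\<^sub>v (f *\<^sub>v x) - Uvar ^ k \<cdot>\<^sub>v (f *\<^sub>v y))
        = f *\<^sub>v (Uvar ^ m \<cdot>\<^sub>v (Uvar ^ l \<cdot>\<^sub>v x - Uvar ^ k \<cdot>\<^sub>v y))"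
      using assms(3) c
      by (simp add: mult_minus_distrib_mat_vec[where nr = "rank D" and nc = "rank C"]
          mult_mat_smult_vec[where nr = "rank D" and nc = "rank C"])
    also have "\<dots> \<in> boundaries D" by (rule chain_map_boundary[OF assms(1-4) m])
    finally have "((f *\<^sub>v x, k), (f *\<^sub>v y, l)) \<in> loc_rel D"
      using chain_map_cycle[OF assms(1-4)] y assms(5) by (auto simp: loc_rel_def)
    then show ?thesis
      unfolding loc_frac_def using equiv_class_eq[OF equiv_loc_rel[OF assms(2)]] by metis
  qed
  have "(x, k) \<in> loc_frac C x k"
    unfolding loc_frac_def using equiv_class_self[OF equiv_loc_rel[OF assms(1)]] assms(5) by auto
  moreover have "(case p of (y, l) \<Rightarrow> loc_frac D (f *\<^sub>v y) l) = loc_frac D (f *\<^sub>v x) k"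
    if "p \<in> loc_frac C x k" for p
    using that eq[of "fst p" "snd p"] by (simp only: prod.collapse case_prod_beta)
  ultimately show ?thesis unfolding loc_map_def by (intro UN_constant_eq) auto
qed

lemma loc_homology_cases:
  assumes "X \<in> loc_homology C"
  obtains x k where "x \<in> cycles C" "X = loc_frac C x k"
proof -
  obtain p where "p \<in> cycles C \<times> UNIV" "X = loc_rel C `` {p}"
    using assms unfolding loc_homology_def by (rule quotientE)
  then show ?thesis using that by (cases p) (auto simp: loc_frac_def)
qed

lemma local_map_comp:
  assumes C: "almost_iota_complex C" and D: "almost_iota_complex D" and E: "almost_iota_complex E"
    and f: "local_map C D f" and g: "local_map D E g"
  shows "local_map C E (g * f)"
proof -
  have grC: "bdry C \<in> graded_maps C C (-1)" "inv\<iota> C \<in> graded_maps C C 0"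
    and grD: "bdry D \<in> graded_maps D D (-1)" "inv\<iota> D \<in> graded_maps D D 0"
    and grE: "bdry E \<in> graded_maps E E (-1)" "inv\<iota> E \<in> graded_maps E E 0"
    using C D E by (auto simp: almost_iota_complex_def)
  have f': "f \<in> graded_maps C D 0" "f * bdry C = bdry D * f"
      "homotopic_mod_U C D (f * inv\<iota> C) (inv\<iota> D * f)"
      "bij_betw (loc_map D f) (loc_homology C) (loc_homology D)"
    and g': "g \<in> graded_maps D E 0" "g * bdry D = bdry E * g"
      "homotopic_mod_U D E (g * inv\<iota> D) (inv\<iota> E * g)"
      "bij_betw (loc_map E g) (loc_homology D) (loc_homology E)"
    using f g by (auto simp: local_map_def)
  note c = grC[THEN graded_mapsD] grD[THEN graded_mapsD] grE[THEN graded_mapsD]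
    f'(1)[THEN graded_mapsD] g'(1)[THEN graded_mapsD]
  have chain: "g * f * bdry C = bdry E * (g * f)"
  proof -
    have "g * f * bdry C = g * (f * bdry C)" using c by (intro assoc_mult_mat) auto
    also have "\<dots> = g * (bdry D * f)" by (simp only: f'(2))
    also have "\<dots> = (g * bdry D) * f" using c by (intro assoc_mult_mat[symmetric]) auto
    also have "\<dots> = (bdry E * g) * f" by (simp only: g'(2))
    also have "\<dots> = bdry E * (g * f)" using c by (intro assoc_mult_mat) auto
    finally show ?thesis .
  qed
  have "loc_map E (g * f) X = (loc_map E g \<circ> loc_map D f) X" if X: "X \<in> loc_homology C" for X
  proof -
    obtain x k where x: "x \<in> cycles C" "X = loc_frac C x k" using X by (rule loc_homology_cases)
    have "loc_map E (g * f) X = loc_frac E ((g * f) *\<^sub>v x) k"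
      unfolding x(2) using c by (intro loc_map_frac chain x(1)) auto
    also have "(g * f) *\<^sub>v x = g *\<^sub>v (f *\<^sub>v x)"
      using c cyclesD[OF x(1)] by (intro assoc_mult_mat_vec) auto
    also have "loc_frac E (g *\<^sub>v (f *\<^sub>v x)) k = loc_map E g (loc_map D f X)"
      using x c f'(2) g'(2) by (simp add: loc_map_frac chain_map_cycle)
    finally show ?thesis by simp
  qed
  moreover have "bij_betw (loc_map E g \<circ> loc_map D f) (loc_homology C) (loc_homology E)"
    using f'(4) g'(4) by (rule bij_betw_trans)
  ultimately have "bij_betw (loc_map E (g * f)) (loc_homology C) (loc_homology E)"
    by (simp cong: bij_betw_cong)
  moreover have "g * f \<in> graded_maps C E 0" using graded_maps_mult[OF f'(1) g'(1)] by simp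
  ultimately show ?thesis unfolding local_map_def
    using chain homotopic_mod_U_comp[OF grC grD grE f'(1-3) g'(1-3)] by blast
qed

lemma graded_maps_one: "1\<^sub>m (rank C) \<in> graded_maps C C 0"
  unfolding graded_maps_def module_maps_def
  using one_mult_mat_vec[OF homogeneous_carrier] by auto

lemma graded_maps_zero: "0\<^sub>m (rank C) (rank C) \<in> graded_maps C C r"
  unfolding graded_maps_def module_maps_def
proof (intro CollectI conjI allI ballI)
  fix d v assume v: "v \<in> homogeneous C d"
  have "0\<^sub>m (rank C) (rank C) *\<^sub>v v = 0\<^sub>v (rank C)"
    using homogeneous_carrier[OF v] by (intro eq_vecI) auto
  then show "0\<^sub>m (rank C) (rank C) *\<^sub>v v \<in> homogeneous C (d + r)"
    by (simp add: homogeneous_def)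
qed simp

lemma local_map_id:
  assumes "almost_iota_complex C"
  shows "local_map C C (1\<^sub>m (rank C))"
proof -
  let ?n = "rank C"
  have c: "bdry C \<in> carrier_mat ?n ?n" "inv\<iota> C \<in> carrier_mat ?n ?n"
    using assms unfolding almost_iota_complex_def by (auto dest: graded_mapsD)
  have gr: "1\<^sub>m ?n \<in> graded_maps C C 0" "0\<^sub>m ?n ?n \<in> graded_maps C C 1"
    by (rule graded_maps_one, rule graded_maps_zero)
  have "1\<^sub>m ?n * inv\<iota> C + inv\<iota> C * 1\<^sub>m ?n + 0\<^sub>m ?n ?n * bdry C + bdry C * 0\<^sub>m ?n ?n
      = Uvar \<cdot>\<^sub>m 0\<^sub>m ?n ?n"
    using c by (intro eq_matI) (auto simp: bit_poly_two)
  then have "homotopic_mod_U C C (1\<^sub>m ?n * inv\<iota> C) (inv\<iota> C * 1\<^sub>m ?n)"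
    unfolding homotopic_mod_U_def im_U_def module_maps_def
    by (intro bexI[OF _ gr(2)] CollectI exI[of _ "0\<^sub>m ?n ?n"]) auto
  moreover have "loc_map C (1\<^sub>m ?n) X = X" if X: "X \<in> loc_homology C" for X
  proof -
    obtain x k where x: "x \<in> cycles C" "X = loc_frac C x k" using X by (rule loc_homology_cases)
    then show ?thesis using c cyclesD[OF x(1)] by (simp add: loc_map_frac)
  qed
  then have "bij_betw (loc_map C (1\<^sub>m ?n)) (loc_homology C) (loc_homology C)"
    using bij_betw_id[of "loc_homology C"] by (simp cong: bij_betw_cong add: id_def)
  ultimately show ?thesis using gr c by (auto simp: local_map_def)
qed


lemma iota_equiv_sym: "iota_equiv C D \<Longrightarrow> iota_equiv D C"
  by (auto simp: iota_equiv_def locally_equivalent_def)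

lemma iota_equiv_trans: "iota_equiv C D \<Longrightarrow> iota_equiv D E \<Longrightarrow> iota_equiv C E"
  unfolding iota_equiv_def locally_equivalent_def by (blast intro: local_map_comp)

lemma iota_equiv_refl: "almost_iota_complex C \<Longrightarrow> iota_equiv C C"
  unfolding iota_equiv_def locally_equivalent_def by (blast intro: local_map_id)


subsection \<open>The trivial complex\<close>

definition trivial_complex :: iota_data where
  "trivial_complex = IotaData [0] (0\<^sub>m 1 1) (1\<^sub>m 1)"

definition laurent_frac :: "bit poly \<Rightarrow> nat \<Rightarrow> (int \<Rightarrow>\<^sub>0 bit)" where
  "laurent_frac p k =
     Abs_poly_mapping (\<lambda>z. if z + int k \<ge> 0 then coeff p (nat (z + int k)) else 0)"

lemma lookup_laurent_frac:
  "Poly_Mapping.lookup (laurent_frac p k) z =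
     (if z + int k \<ge> 0 then coeff p (nat (z + int k)) else 0)"
proof -
  let ?f = "\<lambda>z. if z + int k \<ge> 0 then coeff p (nat (z + int k)) else 0"
  have "{z. ?f z \<noteq> 0} \<subseteq> (\<lambda>n. int n - int k) ` {..degree p}"
  proof
    fix z assume "z \<in> {z. ?f z \<noteq> 0}"
    then have z: "z + int k \<ge> 0" "coeff p (nat (z + int k)) \<noteq> 0"
      by (auto split: if_splits)
    then have "nat (z + int k) \<le> degree p" using le_degree by blast
    then show "z \<in> (\<lambda>n. int n - int k) ` {..degree p}"
      using z(1) by (intro image_eqI[of _ _ "nat (z + int k)"]) auto
  qed
  then have "finite {z. ?f z \<noteq> 0}" using finite_subset by blast
  then show ?thesis unfolding laurent_frac_def by (simp add: Abs_poly_mapping_inverse)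
qed

lemma coeff_Uvar_pow_mult:
  "coeff (Uvar ^ l * p) n = (if n < l then 0 else coeff p (n - l))"
  unfolding Uvar_def monom_power by (simp add: coeff_monom_mult)

lemma laurent_frac_cancel: "laurent_frac (Uvar ^ l * p) (k + l) = laurent_frac p k"
proof (rule poly_mapping_eqI)
  fix z
  show "Poly_Mapping.lookup (laurent_frac (Uvar ^ l * p) (k + l)) z
      = Poly_Mapping.lookup (laurent_frac p k) z"
  proof (cases "z + int k \<ge> 0")
    case True
    then have "nat (z + int (k + l)) = nat (z + int k) + l" by simp
    then show ?thesis using True by (simp add: lookup_laurent_frac coeff_Uvar_pow_mult)
  next
    case False
    then have "z + int (k + l) \<ge> 0 \<Longrightarrow> nat (z + int (k + l)) < l" by simp
    then show ?thesis using False by (auto simp: lookup_laurent_frac coeff_Uvar_pow_mult)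
  qed
qed

lemma laurent_frac_inj:
  assumes "laurent_frac p k = laurent_frac q k"
  shows "p = q"
proof (rule poly_eqI)
  fix n
  have "Poly_Mapping.lookup (laurent_frac p k) (int n - int k)
      = Poly_Mapping.lookup (laurent_frac q k) (int n - int k)" using assms by simp
  then show "coeff p n = coeff q n" by (simp add: lookup_laurent_frac)
qed

lemma laurent_frac_add: "laurent_frac (p + q) k = laurent_frac p k + laurent_frac q k"
  by (rule poly_mapping_eqI) (simp add: lookup_laurent_frac lookup_add)

lemma lookup_laurent_shift:
  fixes p :: "int \<Rightarrow>\<^sub>0 bit"
  shows "Poly_Mapping.lookup (Poly_Mapping.single 1 1 * p) z = Poly_Mapping.lookup p (z - 1)"
proof -
  let ?g = "\<lambda>l. \<Sum>q. Poly_Mapping.lookup p q when z = l + q"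
  have "Poly_Mapping.lookup (Poly_Mapping.single 1 1 * p) z = (\<Sum>l. (1 when 1 = l) * ?g l)"
    by (simp only: lookup_mult lookup_single)
  also have "\<dots> = (\<Sum>l. ?g l when l = 1)"
    by (intro Sum_any.cong) (auto simp: when_def)
  also have "\<dots> = ?g 1" by (rule Sum_any_when_equal)
  also have "\<dots> = (\<Sum>q. Poly_Mapping.lookup p q when q = z - 1)"
    by (intro Sum_any.cong) (auto simp: when_def)
  also have "\<dots> = Poly_Mapping.lookup p (z - 1)" by (rule Sum_any_when_equal)
  finally show ?thesis .
qed

lemma laurent_frac_Uvar:
  "laurent_frac (Uvar * p) k = Poly_Mapping.single 1 1 * laurent_frac p k"
proof (rule poly_mapping_eqI)
  fix z
  have c: "coeff (Uvar * p) n = (if n < 1 then 0 else coeff p (n - 1))" for n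
    using coeff_Uvar_pow_mult[of 1 p n] by simp
  have "z - 1 + int k \<ge> 0 \<Longrightarrow> nat (z - 1 + int k) = nat (z + int k) - 1" by simp
  then show "Poly_Mapping.lookup (laurent_frac (Uvar * p) k) z
      = Poly_Mapping.lookup (Poly_Mapping.single 1 1 * laurent_frac p k) z"
    by (auto simp: lookup_laurent_frac lookup_laurent_shift c)
qed

lemma laurent_frac_surj: "\<exists>p k. laurent_frac p k = q"
proof -
  let ?M = "Max (insert 0 (abs ` Poly_Mapping.keys q))"
  define k where "k = nat ?M"
  have bound: "\<bar>z\<bar> \<le> int k" if "Poly_Mapping.lookup q z \<noteq> 0" for z
  proof -
    have "\<bar>z\<bar> \<le> ?M" using that by (intro Max_ge) (auto simp: in_keys_iff)
    then show ?thesis unfolding k_def by simp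
  qed
  define p where "p = Abs_poly (\<lambda>n. Poly_Mapping.lookup q (int n - int k))"
  have p: "coeff p = (\<lambda>n. Poly_Mapping.lookup q (int n - int k))"
    unfolding p_def
  proof (rule coeff_Abs_poly)
    fix i assume "i > 2 * k"
    then have "\<not> \<bar>int i - int k\<bar> \<le> int k" by linarith
    then show "Poly_Mapping.lookup q (int i - int k) = 0" using bound by blast
  qed
  have "laurent_frac p k = q"
  proof (rule poly_mapping_eqI)
    fix z
    show "Poly_Mapping.lookup (laurent_frac p k) z = Poly_Mapping.lookup q z"
    proof (cases "z + int k \<ge> 0")
      case False
      then have "\<not> \<bar>z\<bar> \<le> int k" by linarith
      then have "Poly_Mapping.lookup q z = 0" using bound by blast
      then show ?thesis using False by (simp add: lookup_laurent_frac)
    qed (simp add: lookup_laurent_frac p)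
  qed
  then show ?thesis by blast
qed

lemma rank_trivial [simp]: "rank trivial_complex = 1"
  by (simp add: rank_def trivial_complex_def)

lemma cycles_trivial: "cycles trivial_complex = carrier_vec 1"
  by (auto simp: cycles_def trivial_complex_def rank_def)

lemma boundaries_trivial: "boundaries trivial_complex = {0\<^sub>v 1}"
proof -
  have "0\<^sub>m 1 1 *\<^sub>v y = (0\<^sub>v 1 :: bit poly vec)" if "y \<in> carrier_vec 1" for y
    using that by (intro eq_vecI) auto
  then have "(\<lambda>y. 0\<^sub>m 1 1 *\<^sub>v y) ` carrier_vec 1 = {0\<^sub>v 1 :: bit poly vec}"
    using zero_carrier_vec[of 1] by (metis (no_types, lifting) image_constant image_cong)
  then have "{0\<^sub>m 1 1 *\<^sub>v y | y. y \<in> carrier_vec 1} = {0\<^sub>v 1 :: bit poly vec}"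
    by (simp only: Setcompr_eq_image)
  then show ?thesis by (simp add: boundaries_def trivial_complex_def rank_def)
qed

lemma loc_rel_trivial:
  "((x, k), (y, l)) \<in> loc_rel trivial_complex \<longleftrightarrow>
     x \<in> carrier_vec 1 \<and> y \<in> carrier_vec 1 \<and> laurent_frac (x $ 0) k = laurent_frac (y $ 0) l"
proof (cases "x \<in> carrier_vec 1 \<and> y \<in> carrier_vec 1")
  case True
  have U: "Uvar ^ m \<noteq> 0" for m unfolding Uvar_def monom_power by simp
  have "Uvar ^ m \<cdot>\<^sub>v (Uvar ^ l \<cdot>\<^sub>v x - Uvar ^ k \<cdot>\<^sub>v y) = 0\<^sub>v 1 \<longleftrightarrow>
      Uvar ^ l * x $ 0 = Uvar ^ k * y $ 0" for m
  proof -
    have "Uvar ^ m \<cdot>\<^sub>v (Uvar ^ l \<cdot>\<^sub>v x - Uvar ^ k \<cdot>\<^sub>v y) = 0\<^sub>v 1 \<longleftrightarrow>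
        Uvar ^ m * (Uvar ^ l * x $ 0 - Uvar ^ k * y $ 0) = 0"
      using True by (auto simp: vec_eq_iff)
    then show ?thesis using U[of m] by (simp only: mult_eq_0_iff right_minus_eq) simp
  qed
  moreover have "Uvar ^ l * x $ 0 = Uvar ^ k * y $ 0 \<longleftrightarrow>
      laurent_frac (x $ 0) k = laurent_frac (y $ 0) l"
    by (metis laurent_frac_cancel laurent_frac_inj add.commute)
  ultimately show ?thesis using True
    by (simp add: loc_rel_def cycles_trivial boundaries_trivial)
qed (auto simp: loc_rel_def cycles_trivial)

lemma loc_homology_trivial: "loc_homology_is_laurent trivial_complex"
proof -
  let ?C = trivial_complex
  define \<Phi> where "\<Phi> X = the_elem ((\<lambda>(x, k). laurent_frac (x $ 0) k) ` X)"
    for X :: "(bit poly vec \<times> nat) set"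
  have \<Phi>: "\<Phi> (loc_frac ?C x k) = laurent_frac (x $ 0) k" if "x \<in> carrier_vec 1" for x k
  proof -
    have "(\<lambda>(x, k). laurent_frac (x $ 0) k) ` loc_frac ?C x k = {laurent_frac (x $ 0) k}"
      using that unfolding loc_frac_def
      by (auto simp: loc_rel_trivial image_iff intro!: bexI[of _ "(x, k)"])
    then show ?thesis by (simp add: \<Phi>_def)
  qed
  have "bij_betw \<Phi> (loc_homology ?C) UNIV"
    unfolding bij_betw_def
  proof
    show "inj_on \<Phi> (loc_homology ?C)"
    proof (rule inj_onI)
      fix X Y assume "X \<in> loc_homology ?C" "Y \<in> loc_homology ?C" and eq: "\<Phi> X = \<Phi> Y"
      then obtain x k y l where x: "x \<in> carrier_vec 1" "X = loc_frac ?C x k"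
        and y: "y \<in> carrier_vec 1" "Y = loc_frac ?C y l"
        by (metis loc_homology_cases cycles_trivial)
      have "laurent_frac (x $ 0) k = laurent_frac (y $ 0) l"
        using eq x y by (simp add: \<Phi>)
      then show "X = Y" unfolding x(2) y(2) loc_frac_def
        using x(1) y(1) by (auto simp: loc_rel_trivial)
    qed
    have "q \<in> \<Phi> ` loc_homology ?C" for q
    proof -
      obtain p k where pk: "laurent_frac p k = q" using laurent_frac_surj by blast
      have "loc_frac ?C (vec 1 (\<lambda>_. p)) k \<in> loc_homology ?C"
        unfolding loc_homology_def loc_frac_def
        by (intro quotientI) (simp add: cycles_trivial)
      moreover have "\<Phi> (loc_frac ?C (vec 1 (\<lambda>_. p)) k) = q" using pk by (simp add: \<Phi>)
      ultimately show ?thesis by blast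
    qed
    then show "\<Phi> ` loc_homology ?C = UNIV" by blast
  qed
  moreover have "\<Phi> (loc_frac ?C (Uvar ^ l \<cdot>\<^sub>v x + Uvar ^ k \<cdot>\<^sub>v y) (k + l))
          = \<Phi> (loc_frac ?C x k) + \<Phi> (loc_frac ?C y l)"
    if "x \<in> carrier_vec 1" "y \<in> carrier_vec 1" for x y k l
  proof -
    have "laurent_frac (Uvar ^ k * y $ 0) (k + l) = laurent_frac (y $ 0) l"
      using laurent_frac_cancel[of k "y $ 0" l] by (simp add: add.commute)
    then show ?thesis using that by (simp add: \<Phi> laurent_frac_add laurent_frac_cancel)
  qed
  moreover have "\<Phi> (loc_frac ?C (Uvar \<cdot>\<^sub>v x) k) = Poly_Mapping.single 1 1 * \<Phi> (loc_frac ?C x k)"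
    if "x \<in> carrier_vec 1" for x k
    using that by (simp add: \<Phi> laurent_frac_Uvar)
  moreover have "\<Phi> (loc_frac ?C x k) \<in> laurent_homogeneous (d + 2 * int k)"
    if "x \<in> carrier_vec 1" "x \<in> homogeneous ?C d" for x k d
  proof -
    have "\<forall>n. coeff (x $ 0) n \<noteq> 0 \<longrightarrow> - 2 * int n = d"
      using that(2) by (auto simp: homogeneous_def trivial_complex_def rank_def)
    then have "- 2 * z = d + 2 * int k" if "Poly_Mapping.lookup (laurent_frac (x $ 0) k) z \<noteq> 0" for z
      using that by (force simp: lookup_laurent_frac split: if_splits)
    then show ?thesis using that(1)
      unfolding laurent_homogeneous_def by (simp add: \<Phi> in_keys_iff)
  qed
  ultimately show ?thesis
    unfolding loc_homology_is_laurent_def cycles_trivial by blast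
qed

lemma almost_iota_complex_trivial: "almost_iota_complex trivial_complex"
proof -
  let ?C = trivial_complex
  have d: "bdry ?C = 0\<^sub>m 1 1" and i: "inv\<iota> ?C = 1\<^sub>m 1"
    by (simp_all add: trivial_complex_def)
  have z: "0\<^sub>m 1 1 \<in> graded_maps ?C ?C r" for r using graded_maps_zero[of ?C] by simp
  have o: "1\<^sub>m 1 \<in> graded_maps ?C ?C 0" using graded_maps_one[of ?C] by simp
  have im: "0\<^sub>m 1 1 \<in> im_U ?C ?C"
    unfolding im_U_def module_maps_def by (auto intro!: exI[of _ "0\<^sub>m 1 1"] eq_matI)
  have "1\<^sub>m 1 * 1\<^sub>m 1 + 1\<^sub>m 1 + 0\<^sub>m 1 1 * 0\<^sub>m 1 1 + 0\<^sub>m 1 1 * 0\<^sub>m 1 1 = (0\<^sub>m 1 1 :: bit poly mat)"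
    by (rule eq_matI) (auto simp: bit_poly_two)
  then have "homotopic_mod_U ?C ?C (1\<^sub>m 1 * 1\<^sub>m 1) (1\<^sub>m 1)"
    unfolding homotopic_mod_U_def d using z[of 1] im by (metis (no_types))
  then show ?thesis
    using z o im loc_homology_trivial by (simp add: almost_iota_complex_def d i)
qed


section \<open>The set of local equivalence classes\<close>

quotient_type local_class = iota_data / partial: iota_equiv
proof (rule part_equivpI)
  show "\<exists>C. iota_equiv C C" using almost_iota_complex_trivial iota_equiv_refl by blast
  show "symp iota_equiv" by (rule sympI) (rule iota_equiv_sym)
  show "transp iota_equiv" by (rule transpI) (rule iota_equiv_trans)
qed


section \<open>Standard complexes\<close>

datatype sign = Plus | Minus

text \<open>The list \<open>[(a\<^sub>1, b\<^sub>2), (a\<^sub>3, b\<^sub>4), \<dots>]\<close> encodes the parameter sequence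
  \<open>(a\<^sub>1, b\<^sub>2, a\<^sub>3, b\<^sub>4, \<dots>)\<close>; \<open>a_par\<close> is meant for odd and \<open>b_par\<close> for positive even indices.\<close>

type_synonym std_params = "(sign \<times> int) list"

definition valid_params :: "std_params \<Rightarrow> bool" where
  "valid_params ps \<longleftrightarrow> (\<forall>(a, b) \<in> set ps. b \<noteq> 0)"

definition a_par :: "std_params \<Rightarrow> nat \<Rightarrow> sign" where
  "a_par ps i = fst (ps ! (i div 2))"

definition b_par :: "std_params \<Rightarrow> nat \<Rightarrow> int" where
  "b_par ps i = snd (ps ! (i div 2 - 1))"

text \<open>The gradings are forced by \<open>gr T\<^sub>0 = 0\<close>, \<open>deg \<partial> = -1\<close>, \<open>deg \<omega> = 0\<close>:
  \<open>T\<^sub>2\<^sub>i\<^sub>-\<^sub>1\<close> has the grading of \<open>T\<^sub>2\<^sub>i\<^sub>-\<^sub>2\<close>, and \<open>gr T\<^sub>2\<^sub>i = gr T\<^sub>2\<^sub>i\<^sub>-\<^sub>1 + sgn b\<^sub>2\<^sub>i - 2 b\<^sub>2\<^sub>i\<close>.\<close>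

definition std_gr :: "std_params \<Rightarrow> nat \<Rightarrow> int" where
  "std_gr ps m = (\<Sum>i = 1..m div 2. sgn (b_par ps (2 * i)) - 2 * b_par ps (2 * i))"

definition std_bdry :: "std_params \<Rightarrow> bit poly mat" where
  "std_bdry ps = mat (2 * length ps + 1) (2 * length ps + 1) (\<lambda>(r, c).
     if even c \<and> c = r + 1 \<and> b_par ps c > 0 then Uvar ^ nat \<bar>b_par ps c\<bar>
     else if even r \<and> r = c + 1 \<and> b_par ps r < 0 then Uvar ^ nat \<bar>b_par ps r\<bar>
     else 0)"

definition std_omega :: "std_params \<Rightarrow> bit poly mat" where
  "std_omega ps = mat (2 * length ps + 1) (2 * length ps + 1) (\<lambda>(r, c).
     if odd c \<and> c = r + 1 \<and> a_par ps c = Plus then 1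
     else if odd r \<and> r = c + 1 \<and> a_par ps r = Minus then 1
     else 0)"

definition standard_complex :: "std_params \<Rightarrow> iota_data" where
  "standard_complex ps = IotaData (map (std_gr ps) [0..<2 * length ps + 1])
     (std_bdry ps) (1\<^sub>m (2 * length ps + 1) + std_omega ps)"

definition grading_shift :: "int \<Rightarrow> iota_data \<Rightarrow> iota_data" where
  "grading_shift s C = IotaData (map (\<lambda>d. d + s) (gr C)) (bdry C) (inv\<iota> C)"

definition standard_representative :: "local_class \<Rightarrow> std_params \<Rightarrow> bool" where
  "standard_representative x ps \<longleftrightarrow> valid_params ps \<and>
     (\<exists>C s. x = abs_local_class C \<and> even s \<and>
        iota_equiv C (grading_shift s (standard_complex ps)))"

definition std_rep :: "local_class \<Rightarrow> std_params" where
  "std_rep x = (THE ps. standard_representative x ps)"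


section \<open>The maps \<open>P\<^sub>\<omega>\<close> and \<open>\<phi>\<^sub>m\<close>\<close>

definition P_omega :: "local_class \<Rightarrow> int" where
  "P_omega x = (let ps = std_rep x in
     int (card {i \<in> {1..2 * length ps}. odd i \<and> a_par ps i = Plus})
     - int (card {i \<in> {1..2 * length ps}. odd i \<and> a_par ps i = Minus}))"

definition phi :: "nat \<Rightarrow> local_class \<Rightarrow> int" where
  "phi m x = (let ps = std_rep x in
     int (card {i \<in> {1..2 * length ps}. even i \<and> b_par ps i = int m})
     - int (card {i \<in> {1..2 * length ps}. even i \<and> b_par ps i = - int m}))"

text \<open>Integer-valued functions on a set form a \<open>\<int>\<close>-module under pointwise operations.\<close>

interpretation int_fun: Modules.module "\<lambda>(c :: int) (f :: 'a \<Rightarrow> int) x. c * f x"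
  by unfold_locales (auto simp: fun_eq_iff algebra_simps)

end

theory Submission
  imports Defs
begin

text \<open>
  A standard complex splits, as a chain complex, into the tower generated by \<open>T\<^sub>0\<close> and the
  pairs \<open>(T\<^sub>2\<^sub>i\<^sub>-\<^sub>1, T\<^sub>2\<^sub>i)\<close>, each of which is \<open>U\<close>-torsion in homology. Hence its localized homology
  is \<open>\<bbbF>[U,U\<^sup>-\<^sup>1]\<close>, read off from the coordinate of a cycle at \<open>T\<^sub>0\<close>, and every standard complex with
  valid parameters is an almost \<open>\<iota>\<close>-complex (\<open>almost_iota_complex_std\<close>).

  The invariants are defined through the standard representative of a class, so evaluating them on
  the class of a standard complex requires that different parameter lists are never locally
  equivalent, even after grading shifts (\<open>std_params_unique\<close>). Let \<open>f\<close> and \<open>g\<close> be local maps in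
  both directions between two standard complexes. Both are nonzero from tower to tower, and since
  they preserve the grading, this forces the shifts to agree and both \<open>T\<^sub>0\<close>-to-\<open>T\<^sub>0\<close> entries to be
  units modulo \<open>U\<close>. Since the differentials vanish modulo \<open>U\<close>, the homotopy in the definition of a
  local map has no effect modulo \<open>U\<close>: the maps commute with \<open>\<partial>\<close>, and with \<open>\<omega>\<close> modulo \<open>U\<close>. Now walk
  along the chain of generators. If the diagonal entry of \<open>f\<close> at one generator is a unit modulo \<open>U\<close>,
  comparing one matrix entry of \<open>f \<omega> = \<omega> f\<close> or \<open>f \<partial> = \<partial> f\<close> shows that the next parameter can only
  increase in the order in which \<open>-\<close> precedes the end of the list, which precedes \<open>+\<close>, and
  \<open>-1 < -2 < \<dots> < 2 < 1\<close>; and if it does not change, the next diagonal entry is again a unit modulo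
  \<open>U\<close>. With \<open>g\<close> giving the reverse inequality, all parameters coincide.

  It remains to evaluate. The complexes \<open>\<C>(\<plusminus>,1,\<dots>,\<plusminus>,1)\<close> with a constant sign realize every value
  of \<open>P\<^sub>\<omega>\<close>. On \<open>\<C>(+,1)\<close> and \<open>\<C>(+,-1)\<close> each \<open>\<phi>\<^sub>m\<close> takes opposite values, so the same is true for
  every element of the span of the \<open>\<phi>\<^sub>m\<close>, whereas \<open>P\<^sub>\<omega>\<close> is \<open>1\<close> on both.
\<close>

section \<open>Matrices over \<open>\<bbbF>[U]\<close>\<close>

text \<open>
  Every generator of a standard complex meets at most one \<open>\<partial>\<close>-arrow and at most one \<open>\<omega>\<close>-arrow, so
  each row and each column of the two matrices has at most one nonzero entry. A product with such
  a matrix is a single term.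
\<close>

lemma mult_mat_single_col:
  fixes A :: "'a :: comm_ring_1 mat"
  assumes "M \<in> carrier_mat l m" "A \<in> carrier_mat m n" "r < l" "c < n" "k < m"
    and "\<And>j. j < m \<Longrightarrow> j \<noteq> k \<Longrightarrow> A $$ (j, c) = 0"
  shows "(M * A) $$ (r, c) = M $$ (r, k) * A $$ (k, c)"
proof -
  have "(M * A) $$ (r, c) = (\<Sum>j = 0..<m. M $$ (r, j) * A $$ (j, c))"
    using assms by (auto simp: scalar_prod_def)
  also have "\<dots> = (\<Sum>j \<in> {k}. M $$ (r, j) * A $$ (j, c))"
    using assms by (intro sum.mono_neutral_right) auto
  finally show ?thesis by simp
qed

lemma mult_mat_vec_single_row:
  fixes A :: "'a :: comm_ring_1 mat"
  assumes "A \<in> carrier_mat l m" "v \<in> carrier_vec m" "r < l" "k < m"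
    and "\<And>j. j < m \<Longrightarrow> j \<noteq> k \<Longrightarrow> A $$ (r, j) = 0"
  shows "(A *\<^sub>v v) $ r = A $$ (r, k) * v $ k"
proof -
  have "(A *\<^sub>v v) $ r = (\<Sum>j = 0..<m. A $$ (r, j) * v $ j)"
    using assms by (auto simp: scalar_prod_def)
  also have "\<dots> = (\<Sum>j \<in> {k}. A $$ (r, j) * v $ j)"
    using assms by (intro sum.mono_neutral_right) auto
  finally show ?thesis by simp
qed

lemma im_U_iff:
  "M \<in> im_U C D \<longleftrightarrow>
     M \<in> carrier_mat (rank D) (rank C) \<and>
     (\<forall>r < rank D. \<forall>c < rank C. coeff (M $$ (r, c)) 0 = 0)"
  (is "?L \<longleftrightarrow> ?R")
proof
  have U: "coeff (Uvar * p) 0 = 0" for p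
    using coeff_Uvar_pow_mult[of 1 p 0] by simp
  assume ?L
  then show ?R by (auto simp: im_U_def module_maps_def U)
next
  assume R: ?R
  define X where "X = mat (rank D) (rank C) (\<lambda>(r, c). poly_shift 1 (M $$ (r, c)))"
  have U: "Uvar * poly_shift 1 p = p" if "coeff p 0 = 0" for p
  proof (rule poly_eqI)
    fix n
    show "coeff (Uvar * poly_shift 1 p) n = coeff p n"
      using coeff_Uvar_pow_mult[of 1 "poly_shift 1 p" n] that
      by (cases n) (auto simp: coeff_poly_shift)
  qed
  have "M = Uvar \<cdot>\<^sub>m X"
    using R by (intro eq_matI) (auto simp: X_def U simp del: One_nat_def)
  then show ?L
    unfolding im_U_def module_maps_def by (auto simp: X_def intro!: exI[of _ X])
qed

lemma coeff_0_mult_mat: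
  fixes A B :: "bit poly mat"
  assumes "A \<in> carrier_mat l m" "B \<in> carrier_mat m n" "r < l" "c < n"
  shows "coeff ((A * B) $$ (r, c)) 0 = (\<Sum>j = 0..<m. coeff (A $$ (r, j)) 0 * coeff (B $$ (j, c)) 0)"
  using assms by (auto simp: scalar_prod_def coeff_sum coeff_mult_0)

lemma graded_mapsI:
  assumes f: "f \<in> carrier_mat (rank D) (rank C)"
    and gr: "\<And>r c k. r < rank D \<Longrightarrow> c < rank C \<Longrightarrow> coeff (f $$ (r, c)) k \<noteq> 0 \<Longrightarrow>
      gr D ! r - 2 * int k = gr C ! c + e"
  shows "f \<in> graded_maps C D e"
  unfolding graded_maps_def module_maps_def
proof (intro CollectI conjI allI ballI)
  show "f \<in> carrier_mat (rank D) (rank C)" by fact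
  fix d v assume v: "v \<in> homogeneous C d"
  have vc: "v \<in> carrier_vec (rank C)" using homogeneous_carrier[OF v] .
  have "gr D ! r - 2 * int k = d + e"
    if r: "r < rank D" and nz: "coeff ((f *\<^sub>v v) $ r) k \<noteq> 0" for r k
  proof -
    have "(f *\<^sub>v v) $ r = (\<Sum>c = 0..<rank C. f $$ (r, c) * v $ c)"
      using f vc r by (auto simp: scalar_prod_def)
    then have "(\<Sum>c = 0..<rank C. coeff (f $$ (r, c) * v $ c) k) \<noteq> 0"
      using nz by (simp add: coeff_sum)
    then obtain c where c: "c < rank C" "coeff (f $$ (r, c) * v $ c) k \<noteq> 0"
      by (meson atLeastLessThan_iff sum.not_neutral_contains_not_neutral)
    then have "(\<Sum>i\<le>k. coeff (f $$ (r, c)) i * coeff (v $ c) (k - i)) \<noteq> 0"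
      by (simp add: coeff_mult)
    then obtain i where i: "i \<le> k" "coeff (f $$ (r, c)) i * coeff (v $ c) (k - i) \<noteq> 0"
      by (meson atMost_iff sum.not_neutral_contains_not_neutral)
    then have nz: "coeff (f $$ (r, c)) i \<noteq> 0" "coeff (v $ c) (k - i) \<noteq> 0" by (metis mult_zero_left mult_zero_right)+
    have "gr D ! r - 2 * int i = gr C ! c + e" using gr[OF r c(1) nz(1)] .
    moreover have "gr C ! c - 2 * int (k - i) = d"
      using v c(1) nz(2) unfolding homogeneous_def by blast
    moreover have "int (k - i) = int k - int i" using i(1) by (rule of_nat_diff)
    ultimately show ?thesis by linarith
  qed
  then show "f *\<^sub>v v \<in> homogeneous D (d + e)"
    using f vc by (auto simp: homogeneous_def)
qed

text \<open>
  The \<open>c\<close>-th generator is homogeneous, and its image is the \<open>c\<close>-th column of \<open>f\<close>.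
\<close>

lemma graded_maps_entry:
  assumes f: "f \<in> graded_maps C D e" and "r < rank D" "c < rank C" "coeff (f $$ (r, c)) k \<noteq> 0"
  shows "gr D ! r - 2 * int k = gr C ! c + e"
proof -
  have "unit_vec (rank C) c \<in> homogeneous C (gr C ! c)"
    using assms(3) by (auto simp: homogeneous_def unit_vec_def split: if_splits)
  then have "f *\<^sub>v unit_vec (rank C) c \<in> homogeneous D (gr C ! c + e)"
    using f unfolding graded_maps_def by blast
  moreover have "(f *\<^sub>v unit_vec (rank C) c) $ r = f $$ (r, c)"
    using graded_mapsD[OF f] assms(2,3) by auto
  ultimately show ?thesis using assms(2,4) unfolding homogeneous_def by auto
qed


section \<open>The two arrow patterns of a standard complex\<close>

lemma std_bdry_carrier [simp]:
  "std_bdry ps \<in> carrier_mat (2 * length ps + 1) (2 * length ps + 1)"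
  "std_bdry ps \<in> carrier_mat (Suc (2 * length ps)) (Suc (2 * length ps))"
  by (simp_all add: std_bdry_def)

lemma std_omega_carrier [simp]:
  "std_omega ps \<in> carrier_mat (2 * length ps + 1) (2 * length ps + 1)"
  "std_omega ps \<in> carrier_mat (Suc (2 * length ps)) (Suc (2 * length ps))"
  by (simp_all add: std_omega_def)

lemma std_dim [simp]:
  "dim_row (std_bdry ps) = 2 * length ps + 1" "dim_col (std_bdry ps) = 2 * length ps + 1"
  "dim_row (std_omega ps) = 2 * length ps + 1" "dim_col (std_omega ps) = 2 * length ps + 1"
  by (simp_all add: std_bdry_def std_omega_def)

lemma std_bdry_eq_0:
  assumes "r < 2 * length ps + 1" "c < 2 * length ps + 1"
    and "\<And>i. \<not> (r = 2 * i + 1 \<and> c = 2 * i + 2)" "\<And>i. \<not> (r = 2 * i + 2 \<and> c = 2 * i + 1)"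
  shows "std_bdry ps $$ (r, c) = 0"
proof -
  have "\<not> (even c \<and> c = r + 1)" using assms(3)[of "r div 2"] by presburger
  moreover have "\<not> (even r \<and> r = c + 1)" using assms(4)[of "c div 2"] by presburger
  ultimately show ?thesis using assms(1,2) unfolding std_bdry_def by auto
qed

lemma std_bdry_down:
  "i < length ps \<Longrightarrow> std_bdry ps $$ (2 * i + 1, 2 * i + 2) =
     (if snd (ps ! i) > 0 then Uvar ^ nat \<bar>snd (ps ! i)\<bar> else 0)"
  by (simp add: std_bdry_def b_par_def)

lemma std_bdry_up:
  "i < length ps \<Longrightarrow> std_bdry ps $$ (2 * i + 2, 2 * i + 1) =
     (if snd (ps ! i) < 0 then Uvar ^ nat \<bar>snd (ps ! i)\<bar> else 0)"
  by (simp add: std_bdry_def b_par_def)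

lemma std_omega_eq_0:
  assumes "r < 2 * length ps + 1" "c < 2 * length ps + 1"
    and "\<And>i. \<not> (r = 2 * i \<and> c = 2 * i + 1)" "\<And>i. \<not> (r = 2 * i + 1 \<and> c = 2 * i)"
  shows "std_omega ps $$ (r, c) = 0"
proof -
  have "\<not> (odd c \<and> c = r + 1)" using assms(3)[of "r div 2"] by presburger
  moreover have "\<not> (odd r \<and> r = c + 1)" using assms(4)[of "c div 2"] by presburger
  ultimately show ?thesis using assms(1,2) unfolding std_omega_def by auto
qed

lemma std_omega_down:
  "i < length ps \<Longrightarrow> std_omega ps $$ (2 * i, 2 * i + 1) = (if fst (ps ! i) = Plus then 1 else 0)"
  by (simp add: std_omega_def a_par_def)

lemma std_omega_up:
  "i < length ps \<Longrightarrow> std_omega ps $$ (2 * i + 1, 2 * i) = (if fst (ps ! i) = Minus then 1 else 0)"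
  by (simp add: std_omega_def a_par_def)

text \<open>
  The decomposition of the generators into \<open>T\<^sub>0\<close> and the \<open>\<partial>\<close>-pairs; the list position \<open>i\<close> holds the
  parameters \<open>(a\<^sub>2\<^sub>i\<^sub>+\<^sub>1, b\<^sub>2\<^sub>i\<^sub>+\<^sub>2)\<close>.
\<close>

lemma std_index_cases:
  assumes "r < 2 * length ps + 1"
  obtains "r = 0" | i where "i < length ps" "r = 2 * i + 1" | i where "i < length ps" "r = 2 * i + 2"
proof (cases "odd r")
  case True
  then obtain i where "r = 2 * i + 1" by (rule oddE)
  then show ?thesis using that(2)[of i] assms by simp
next
  case False
  then obtain i where i: "r = 2 * i" by (auto elim: evenE)
  show ?thesis
  proof (cases i)
    case 0
    then show ?thesis using that(1) i by simp
  next
    case (Suc j)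
    then show ?thesis using that(3)[of j] i assms by simp
  qed
qed

lemma std_bdry_mult_vec:
  assumes v: "v \<in> carrier_vec (2 * length ps + 1)"
  shows "(std_bdry ps *\<^sub>v v) $ 0 = 0"
    and "i < length ps \<Longrightarrow> (std_bdry ps *\<^sub>v v) $ (2 * i + 1) =
      (if snd (ps ! i) > 0 then Uvar ^ nat \<bar>snd (ps ! i)\<bar> * v $ (2 * i + 2) else 0)"
    and "i < length ps \<Longrightarrow> (std_bdry ps *\<^sub>v v) $ (2 * i + 2) =
      (if snd (ps ! i) < 0 then Uvar ^ nat \<bar>snd (ps ! i)\<bar> * v $ (2 * i + 1) else 0)"
proof -
  note single = mult_mat_vec_single_row[OF std_bdry_carrier(1) v]
  have "(std_bdry ps *\<^sub>v v) $ 0 = std_bdry ps $$ (0, 0) * v $ 0"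
    by (rule single) (auto intro!: std_bdry_eq_0)
  also have "std_bdry ps $$ (0, 0) = 0" by (rule std_bdry_eq_0) auto
  finally show "(std_bdry ps *\<^sub>v v) $ 0 = 0" by simp
  assume i: "i < length ps"
  have "(std_bdry ps *\<^sub>v v) $ (2 * i + 1) = std_bdry ps $$ (2 * i + 1, 2 * i + 2) * v $ (2 * i + 2)"
    using i by (intro single std_bdry_eq_0) (simp | presburger)+
  then show "(std_bdry ps *\<^sub>v v) $ (2 * i + 1) =
      (if snd (ps ! i) > 0 then Uvar ^ nat \<bar>snd (ps ! i)\<bar> * v $ (2 * i + 2) else 0)"
    unfolding std_bdry_down[OF i] by simp
  have "(std_bdry ps *\<^sub>v v) $ (2 * i + 2) = std_bdry ps $$ (2 * i + 2, 2 * i + 1) * v $ (2 * i + 1)"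
    using i by (intro single std_bdry_eq_0) (simp | presburger)+
  then show "(std_bdry ps *\<^sub>v v) $ (2 * i + 2) =
      (if snd (ps ! i) < 0 then Uvar ^ nat \<bar>snd (ps ! i)\<bar> * v $ (2 * i + 1) else 0)"
    unfolding std_bdry_up[OF i] by simp
qed

lemma std_bdry_mult:
  assumes f: "f \<in> carrier_mat (2 * length ps + 1) n" and c: "c < n"
  shows "(std_bdry ps * f) $$ (0, c) = 0"
    and "i < length ps \<Longrightarrow> (std_bdry ps * f) $$ (2 * i + 1, c) =
      (if snd (ps ! i) > 0 then Uvar ^ nat \<bar>snd (ps ! i)\<bar> * f $$ (2 * i + 2, c) else 0)"
    and "i < length ps \<Longrightarrow> (std_bdry ps * f) $$ (2 * i + 2, c) =
      (if snd (ps ! i) < 0 then Uvar ^ nat \<bar>snd (ps ! i)\<bar> * f $$ (2 * i + 1, c) else 0)"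
proof -
  have v: "col f c \<in> carrier_vec (2 * length ps + 1)"
    using f by (intro carrier_vecI) auto
  have e: "(std_bdry ps * f) $$ (r, c) = (std_bdry ps *\<^sub>v col f c) $ r"
    if "r < 2 * length ps + 1" for r
    using that f c by auto
  show "(std_bdry ps * f) $$ (0, c) = 0" using e[of 0] std_bdry_mult_vec(1)[OF v] by simp
  show "i < length ps \<Longrightarrow> (std_bdry ps * f) $$ (2 * i + 1, c) =
      (if snd (ps ! i) > 0 then Uvar ^ nat \<bar>snd (ps ! i)\<bar> * f $$ (2 * i + 2, c) else 0)"
    using e[of "2 * i + 1"] std_bdry_mult_vec(2)[OF v] f c by auto
  show "i < length ps \<Longrightarrow> (std_bdry ps * f) $$ (2 * i + 2, c) =
      (if snd (ps ! i) < 0 then Uvar ^ nat \<bar>snd (ps ! i)\<bar> * f $$ (2 * i + 1, c) else 0)"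
    using e[of "2 * i + 2"] std_bdry_mult_vec(3)[OF v] f c by auto
qed

lemma mult_std_bdry:
  assumes f: "f \<in> carrier_mat m (2 * length ps + 1)" and r: "r < m" and i: "i < length ps"
  shows "(f * std_bdry ps) $$ (r, 2 * i + 1) =
      (if snd (ps ! i) < 0 then f $$ (r, 2 * i + 2) * Uvar ^ nat \<bar>snd (ps ! i)\<bar> else 0)"
    and "(f * std_bdry ps) $$ (r, 2 * i + 2) =
      (if snd (ps ! i) > 0 then f $$ (r, 2 * i + 1) * Uvar ^ nat \<bar>snd (ps ! i)\<bar> else 0)"
proof -
  note single = mult_mat_single_col[OF f std_bdry_carrier(1) r]
  have "(f * std_bdry ps) $$ (r, 2 * i + 1) = f $$ (r, 2 * i + 2) * std_bdry ps $$ (2 * i + 2, 2 * i + 1)"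
    using i by (intro single std_bdry_eq_0) (simp | presburger)+
  then show "(f * std_bdry ps) $$ (r, 2 * i + 1) =
      (if snd (ps ! i) < 0 then f $$ (r, 2 * i + 2) * Uvar ^ nat \<bar>snd (ps ! i)\<bar> else 0)"
    unfolding std_bdry_up[OF i] by simp
  have "(f * std_bdry ps) $$ (r, 2 * i + 2) = f $$ (r, 2 * i + 1) * std_bdry ps $$ (2 * i + 1, 2 * i + 2)"
    using i by (intro single std_bdry_eq_0) (simp | presburger)+
  then show "(f * std_bdry ps) $$ (r, 2 * i + 2) =
      (if snd (ps ! i) > 0 then f $$ (r, 2 * i + 1) * Uvar ^ nat \<bar>snd (ps ! i)\<bar> else 0)"
    unfolding std_bdry_down[OF i] by simp
qed

lemma std_omega_mult:
  assumes f: "f \<in> carrier_mat (2 * length ps + 1) n" and c: "c < n"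
  shows "i \<le> length ps \<Longrightarrow> (std_omega ps * f) $$ (2 * i, c) =
      (if i < length ps \<and> fst (ps ! i) = Plus then f $$ (2 * i + 1, c) else 0)"
    and "i < length ps \<Longrightarrow> (std_omega ps * f) $$ (2 * i + 1, c) =
      (if fst (ps ! i) = Minus then f $$ (2 * i, c) else 0)"
proof -
  have v: "col f c \<in> carrier_vec (2 * length ps + 1)"
    using f by (intro carrier_vecI) auto
  have e: "(std_omega ps * f) $$ (r, c) = (std_omega ps *\<^sub>v col f c) $ r"
    if "r < 2 * length ps + 1" for r
    using that f c by auto
  note single = mult_mat_vec_single_row[OF std_omega_carrier(1) v]
  show "(std_omega ps * f) $$ (2 * i, c) =
      (if i < length ps \<and> fst (ps ! i) = Plus then f $$ (2 * i + 1, c) else 0)"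
    if i: "i \<le> length ps"
  proof (cases "i < length ps")
    case True
    have "(std_omega ps *\<^sub>v col f c) $ (2 * i) = std_omega ps $$ (2 * i, 2 * i + 1) * col f c $ (2 * i + 1)"
      using True by (intro single std_omega_eq_0) (simp | presburger)+
    then show ?thesis
      unfolding std_omega_down[OF True] using e[of "2 * i"] True f c by auto
  next
    case False
    then have L: "i = length ps" using i by simp
    have z: "std_omega ps $$ (2 * i, j) = 0" if "j < 2 * length ps + 1" for j
      using that unfolding L by (intro std_omega_eq_0) presburger+
    have "(std_omega ps *\<^sub>v col f c) $ (2 * i) = std_omega ps $$ (2 * i, 0) * col f c $ 0"
      using L by (intro single z) auto
    then show ?thesis using z[of 0] e[of "2 * i"] L by simp
  qed
  assume i: "i < length ps"
  have "(std_omega ps *\<^sub>v col f c) $ (2 * i + 1) = std_omega ps $$ (2 * i + 1, 2 * i) * col f c $ (2 * i)"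
    using i by (intro single std_omega_eq_0) (simp | presburger)+
  then show "(std_omega ps * f) $$ (2 * i + 1, c) =
      (if fst (ps ! i) = Minus then f $$ (2 * i, c) else 0)"
    unfolding std_omega_up[OF i] using e[of "2 * i + 1"] i f c by auto
qed

lemma mult_std_omega:
  assumes f: "f \<in> carrier_mat m (2 * length ps + 1)" and r: "r < m"
  shows "i < length ps \<Longrightarrow> (f * std_omega ps) $$ (r, 2 * i + 1) =
      (if fst (ps ! i) = Plus then f $$ (r, 2 * i) else 0)"
    and "i \<le> length ps \<Longrightarrow> (f * std_omega ps) $$ (r, 2 * i) =
      (if i < length ps \<and> fst (ps ! i) = Minus then f $$ (r, 2 * i + 1) else 0)"
proof -
  note single = mult_mat_single_col[OF f std_omega_carrier(1) r]
  show "(f * std_omega ps) $$ (r, 2 * i) =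
      (if i < length ps \<and> fst (ps ! i) = Minus then f $$ (r, 2 * i + 1) else 0)"
    if i: "i \<le> length ps"
  proof (cases "i < length ps")
    case True
    have "(f * std_omega ps) $$ (r, 2 * i) = f $$ (r, 2 * i + 1) * std_omega ps $$ (2 * i + 1, 2 * i)"
      using True by (intro single std_omega_eq_0) (simp | presburger)+
    then show ?thesis unfolding std_omega_up[OF True] using True by simp
  next
    case False
    then have L: "i = length ps" using i by simp
    have z: "std_omega ps $$ (j, 2 * i) = 0" if "j < 2 * length ps + 1" for j
      using that unfolding L by (intro std_omega_eq_0) presburger+
    have "(f * std_omega ps) $$ (r, 2 * i) = f $$ (r, 0) * std_omega ps $$ (0, 2 * i)"
      using L by (intro single z) auto
    then show ?thesis using z[of 0] L by simp
  qed
  assume i: "i < length ps"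
  have "(f * std_omega ps) $$ (r, 2 * i + 1) = f $$ (r, 2 * i) * std_omega ps $$ (2 * i, 2 * i + 1)"
    using i by (intro single std_omega_eq_0) (simp | presburger)+
  then show "(f * std_omega ps) $$ (r, 2 * i + 1) =
      (if fst (ps ! i) = Plus then f $$ (r, 2 * i) else 0)"
    unfolding std_omega_down[OF i] by simp
qed


section \<open>Localized homology detected by one coordinate\<close>

text \<open>
  The chain complex looks, after inverting \<open>U\<close>, like a free module on the generator with index \<open>0\<close>:
  that generator is a cycle, and a cycle is \<open>U\<close>-torsion in homology exactly if it does not involve
  that generator. It is stable under
  grading shifts, so it serves for both ends of the local maps below.
\<close>

definition tower_coordinate :: "iota_data \<Rightarrow> bool" where
  "tower_coordinate C \<longleftrightarrow> rank C > 0 \<and> bdry C \<in> carrier_mat (rank C) (rank C) \<and>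
     unit_vec (rank C) 0 \<in> cycles C \<and>
     (\<forall>x \<in> cycles C. x $ 0 = 0 \<longleftrightarrow> (\<exists>m. Uvar ^ m \<cdot>\<^sub>v x \<in> boundaries C))"

lemma cycles_lincomb:
  assumes "bdry C \<in> carrier_mat (rank C) (rank C)" "x \<in> cycles C" "y \<in> cycles C"
  shows "a \<cdot>\<^sub>v x + b \<cdot>\<^sub>v y \<in> cycles C"
proof -
  have "bdry C *\<^sub>v (a \<cdot>\<^sub>v x + b \<cdot>\<^sub>v y) = a \<cdot>\<^sub>v (bdry C *\<^sub>v x) + b \<cdot>\<^sub>v (bdry C *\<^sub>v y)"
    using assms(1) cyclesD[OF assms(2)] cyclesD[OF assms(3)]
    by (simp add: mult_add_distrib_mat_vec[where nr = "rank C" and nc = "rank C"]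
        mult_mat_smult_vec[where nr = "rank C" and nc = "rank C"])
  then show ?thesis using assms(2,3) unfolding cycles_def by auto
qed

lemma laurent_frac_eq_iff: "laurent_frac p k = laurent_frac q l \<longleftrightarrow> Uvar ^ l * p = Uvar ^ k * q"
proof -
  have "laurent_frac q l = laurent_frac (Uvar ^ k * q) (k + l)"
    using laurent_frac_cancel[of k q l] by (simp add: add.commute)
  then show ?thesis using laurent_frac_cancel[of l p k] laurent_frac_inj by metis
qed

text \<open>
  The fraction \<open>[x]/U\<^sup>k\<close> is determined by the Laurent polynomial \<open>x\<^sub>0/U\<^sup>k\<close>, because the difference
  of two fractions is represented by a cycle, and this is torsion iff its coordinate \<open>0\<close> vanishes.
\<close>

lemma loc_rel_tower:
  assumes C: "tower_coordinate C" and xy: "x \<in> cycles C" "y \<in> cycles C"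
  shows "((x, k), (y, l)) \<in> loc_rel C \<longleftrightarrow> laurent_frac (x $ 0) k = laurent_frac (y $ 0) l"
proof -
  let ?z = "Uvar ^ l \<cdot>\<^sub>v x - Uvar ^ k \<cdot>\<^sub>v y"
  have r: "rank C > 0" and c: "bdry C \<in> carrier_mat (rank C) (rank C)"
    using C unfolding tower_coordinate_def by blast+
  have "?z = Uvar ^ l \<cdot>\<^sub>v x + (- (Uvar ^ k)) \<cdot>\<^sub>v y"
    using xy[THEN cyclesD] by (intro eq_vecI) auto
  then have z: "?z \<in> cycles C" using cycles_lincomb[OF c xy] by simp
  have "((x, k), (y, l)) \<in> loc_rel C \<longleftrightarrow> (\<exists>m. Uvar ^ m \<cdot>\<^sub>v ?z \<in> boundaries C)"
    using xy by (simp add: loc_rel_def)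
  also have "\<dots> \<longleftrightarrow> ?z $ 0 = 0"
    using C z unfolding tower_coordinate_def by blast
  also have "?z $ 0 = Uvar ^ l * x $ 0 - Uvar ^ k * y $ 0"
    using r xy[THEN cyclesD] by auto
  also have "(Uvar ^ l * x $ 0 - Uvar ^ k * y $ 0 = 0) \<longleftrightarrow> Uvar ^ l * x $ 0 = Uvar ^ k * y $ 0"
    by (rule right_minus_eq)
  also have "\<dots> \<longleftrightarrow> laurent_frac (x $ 0) k = laurent_frac (y $ 0) l"
    by (rule laurent_frac_eq_iff[symmetric])
  finally show ?thesis .
qed

lemma loc_frac_tower:
  assumes "tower_coordinate C" "x \<in> cycles C" "y \<in> cycles C"
  shows "loc_frac C x k = loc_frac C y l \<longleftrightarrow> laurent_frac (x $ 0) k = laurent_frac (y $ 0) l"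
proof -
  have "equiv (cycles C \<times> UNIV) (loc_rel C)"
    using assms(1) by (intro equiv_loc_rel) (simp add: tower_coordinate_def)
  then show ?thesis
    using assms eq_equiv_class_iff[of "cycles C \<times> UNIV" "loc_rel C" "(x, k)" "(y, l)"]
    by (simp add: loc_frac_def loc_rel_tower)
qed

lemma loc_homology_is_laurent_tower:
  assumes C: "tower_coordinate C" and gr: "gr C ! 0 = 0"
  shows "loc_homology_is_laurent C"
proof -
  have r: "rank C > 0" and c: "bdry C \<in> carrier_mat (rank C) (rank C)"
    and e: "unit_vec (rank C) 0 \<in> cycles C"
    using C unfolding tower_coordinate_def by blast+
  \<comment> \<open>The isomorphism sends \<open>[x]/U\<^sup>k\<close> to \<open>x\<^sub>0/U\<^sup>k\<close>, which is constant on each class.\<close>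
  define \<Phi> where "\<Phi> X = the_elem ((\<lambda>(x, k). laurent_frac (x $ 0) k) ` X)"
    for X :: "(bit poly vec \<times> nat) set"
  have \<Phi>: "\<Phi> (loc_frac C x k) = laurent_frac (x $ 0) k" if x: "x \<in> cycles C" for x k
  proof -
    have mem: "(x, k) \<in> loc_frac C x k"
      unfolding loc_frac_def using x by (simp add: loc_rel_tower[OF C])
    have const: "laurent_frac (y $ 0) l = laurent_frac (x $ 0) k"
      if "(y, l) \<in> loc_frac C x k" for y l
    proof -
      have xy: "((x, k), (y, l)) \<in> loc_rel C" using that by (simp add: loc_frac_def)
      then have "y \<in> cycles C" by (simp add: loc_rel_def)
      from xy[unfolded loc_rel_tower[OF C x this]] show ?thesis by (rule sym)
    qed
    have "(\<lambda>(x, k). laurent_frac (x $ 0) k) ` loc_frac C x k = {laurent_frac (x $ 0) k}"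
    proof (rule subset_antisym)
      show "(\<lambda>(x, k). laurent_frac (x $ 0) k) ` loc_frac C x k \<subseteq> {laurent_frac (x $ 0) k}"
        by (rule image_subsetI) (metis const case_prod_conv singletonI surj_pair)
      show "{laurent_frac (x $ 0) k} \<subseteq> (\<lambda>(x, k). laurent_frac (x $ 0) k) ` loc_frac C x k"
        using mem by force
    qed
    then show ?thesis by (simp add: \<Phi>_def)
  qed
  have cyc: "a \<cdot>\<^sub>v x + b \<cdot>\<^sub>v y \<in> cycles C" if "x \<in> cycles C" "y \<in> cycles C" for a b x y
    using cycles_lincomb[OF c that] .
  have cyc1: "a \<cdot>\<^sub>v x \<in> cycles C" if "x \<in> cycles C" for a x
  proof -
    have "a \<cdot>\<^sub>v x + 0 \<cdot>\<^sub>v x = a \<cdot>\<^sub>v x" using cyclesD[OF that] by (intro eq_vecI) auto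
    then show ?thesis using cyc[OF that that, of a 0] by simp
  qed
  have "bij_betw \<Phi> (loc_homology C) UNIV"
    unfolding bij_betw_def
  proof
    show "inj_on \<Phi> (loc_homology C)"
    proof (rule inj_onI)
      fix X Y assume "X \<in> loc_homology C" "Y \<in> loc_homology C" and eq: "\<Phi> X = \<Phi> Y"
      then obtain x k y l where x: "x \<in> cycles C" "X = loc_frac C x k"
        and y: "y \<in> cycles C" "Y = loc_frac C y l"
        by (elim loc_homology_cases)
      then show "X = Y" using eq by (simp add: \<Phi> loc_frac_tower[OF C])
    qed
    have "q \<in> \<Phi> ` loc_homology C" for q
    proof -
      obtain p k where pk: "laurent_frac p k = q" using laurent_frac_surj by blast
      let ?x = "p \<cdot>\<^sub>v unit_vec (rank C) 0"
      have "loc_frac C ?x k \<in> loc_homology C"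
        unfolding loc_homology_def loc_frac_def by (intro quotientI) (simp add: cyc1[OF e])
      moreover have "\<Phi> (loc_frac C ?x k) = q" using pk r by (simp add: \<Phi> cyc1[OF e])
      ultimately show ?thesis by blast
    qed
    then show "\<Phi> ` loc_homology C = UNIV" by blast
  qed
  moreover have "\<Phi> (loc_frac C (Uvar ^ l \<cdot>\<^sub>v x + Uvar ^ k \<cdot>\<^sub>v y) (k + l))
          = \<Phi> (loc_frac C x k) + \<Phi> (loc_frac C y l)"
    if xy: "x \<in> cycles C" "y \<in> cycles C" for x y k l
  proof -
    have "laurent_frac (Uvar ^ k * y $ 0) (k + l) = laurent_frac (y $ 0) l"
      using laurent_frac_cancel[of k "y $ 0" l] by (simp add: add.commute)
    moreover have "(Uvar ^ l \<cdot>\<^sub>v x + Uvar ^ k \<cdot>\<^sub>v y) $ 0 = Uvar ^ l * x $ 0 + Uvar ^ k * y $ 0"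
      using r xy[THEN cyclesD] by auto
    ultimately show ?thesis using xy by (simp add: \<Phi> cyc laurent_frac_add laurent_frac_cancel)
  qed
  moreover have "\<Phi> (loc_frac C (Uvar \<cdot>\<^sub>v x) k) = Poly_Mapping.single 1 1 * \<Phi> (loc_frac C x k)"
    if x: "x \<in> cycles C" for x k
  proof -
    have "(Uvar \<cdot>\<^sub>v x) $ 0 = Uvar * x $ 0" using r cyclesD[OF x] by auto
    then show ?thesis using x by (simp add: \<Phi> cyc1 laurent_frac_Uvar)
  qed
  moreover have "\<Phi> (loc_frac C x k) \<in> laurent_homogeneous (d + 2 * int k)"
    if x: "x \<in> cycles C \<inter> homogeneous C d" for x k d
  proof -
    have "\<forall>n. coeff (x $ 0) n \<noteq> 0 \<longrightarrow> - 2 * int n = d"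
      using x r gr by (auto simp: homogeneous_def)
    then have "- 2 * z = d + 2 * int k" if "Poly_Mapping.lookup (laurent_frac (x $ 0) k) z \<noteq> 0" for z
      using that by (force simp: lookup_laurent_frac split: if_splits)
    then show ?thesis using x unfolding laurent_homogeneous_def by (simp add: \<Phi> in_keys_iff)
  qed
  ultimately show ?thesis
    unfolding loc_homology_is_laurent_def by (intro exI[of _ \<Phi>] conjI ballI allI) simp_all
qed


section \<open>Standard complexes are almost \<open>\<iota>\<close>-complexes\<close>

lemma rank_standard_complex [simp]: "rank (standard_complex ps) = 2 * length ps + 1"
  by (simp add: rank_def standard_complex_def)

lemma bdry_standard_complex [simp]: "bdry (standard_complex ps) = std_bdry ps"
  by (simp add: standard_complex_def)

lemma inv_standard_complex [simp]:
  "inv\<iota> (standard_complex ps) = 1\<^sub>m (2 * length ps + 1) + std_omega ps"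
  by (simp add: standard_complex_def)

lemma gr_standard_complex:
  "i < 2 * length ps + 1 \<Longrightarrow> gr (standard_complex ps) ! i = std_gr ps i"
  by (simp add: standard_complex_def del: upt_Suc)

lemma std_gr_odd: "std_gr ps (2 * i + 1) = std_gr ps (2 * i)"
  by (simp add: std_gr_def)

lemma std_gr_even:
  "std_gr ps (2 * i + 2) = std_gr ps (2 * i + 1) + sgn (snd (ps ! i)) - 2 * snd (ps ! i)"
  by (simp add: std_gr_def b_par_def)

lemma std_bdry_graded: "std_bdry ps \<in> graded_maps (standard_complex ps) (standard_complex ps) (-1)"
proof (rule graded_mapsI)
  fix r c k
  assume rc: "r < rank (standard_complex ps)" "c < rank (standard_complex ps)"
    and nz: "coeff (std_bdry ps $$ (r, c)) k \<noteq> 0"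
  have U: "n = k" if "coeff (Uvar ^ n) k \<noteq> 0" for n
    using that coeff_Uvar_pow_mult[of n 1 k] by (auto split: if_splits)
  have rc': "r < 2 * length ps + 1" "c < 2 * length ps + 1" using rc by simp_all
  have "std_bdry ps $$ (r, c) \<noteq> 0" using nz by auto
  then consider i where "r = 2 * i + 1" "c = 2 * i + 2" | i where "r = 2 * i + 2" "c = 2 * i + 1"
    using std_bdry_eq_0[OF rc'] by blast
  then show "gr (standard_complex ps) ! r - 2 * int k = gr (standard_complex ps) ! c + (-1)"
  proof cases
    case (1 i)
    then have i: "i < length ps" using rc' by simp
    have b: "snd (ps ! i) > 0" "nat \<bar>snd (ps ! i)\<bar> = k"
      using nz U unfolding 1 std_bdry_down[OF i] by (auto split: if_splits)
    show ?thesis unfolding gr_standard_complex[OF rc'(1)] gr_standard_complex[OF rc'(2)]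
      unfolding 1 std_gr_even using b by (simp add: std_gr_odd)
  next
    case (2 i)
    then have i: "i < length ps" using rc' by simp
    have b: "snd (ps ! i) < 0" "nat \<bar>snd (ps ! i)\<bar> = k"
      using nz U unfolding 2 std_bdry_up[OF i] by (auto split: if_splits)
    show ?thesis unfolding gr_standard_complex[OF rc'(1)] gr_standard_complex[OF rc'(2)]
      unfolding 2 std_gr_even using b by (simp add: std_gr_odd)
  qed
qed simp

lemma std_omega_graded: "std_omega ps \<in> graded_maps (standard_complex ps) (standard_complex ps) 0"
proof (rule graded_mapsI)
  fix r c k
  assume rc: "r < rank (standard_complex ps)" "c < rank (standard_complex ps)"
    and nz: "coeff (std_omega ps $$ (r, c)) k \<noteq> 0"
  have rc': "r < 2 * length ps + 1" "c < 2 * length ps + 1" using rc by simp_all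
  have "std_omega ps $$ (r, c) \<in> {0, 1}"
    using rc' by (auto simp: std_omega_def)
  then have "k = 0" using nz by (auto split: if_splits)
  moreover have "std_omega ps $$ (r, c) \<noteq> 0" using nz by auto
  then have "(\<exists>i. r = 2 * i \<and> c = 2 * i + 1) \<or> (\<exists>i. r = 2 * i + 1 \<and> c = 2 * i)"
    using std_omega_eq_0[OF rc'] by blast
  then have "std_gr ps r = std_gr ps c" using std_gr_odd by auto
  ultimately show "gr (standard_complex ps) ! r - 2 * int k = gr (standard_complex ps) ! c + 0"
    using rc' by (simp add: gr_standard_complex)
qed simp

lemma std_bdry_squared: "std_bdry ps * std_bdry ps = 0\<^sub>m (2 * length ps + 1) (2 * length ps + 1)"
proof (rule eq_matI)
  fix r c
  assume "r < dim_row (0\<^sub>m (2 * length ps + 1) (2 * length ps + 1))"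
    and "c < dim_col (0\<^sub>m (2 * length ps + 1) (2 * length ps + 1))"
  then have r: "r < 2 * length ps + 1" and c: "c < 2 * length ps + 1" by simp_all
  let ?I = "1\<^sub>m (2 * length ps + 1) :: bit poly mat"
  \<comment> \<open>The row formulas apply to products only; for \<open>\<partial>\<close> itself they are used in the form \<open>\<partial> 1\<close>.\<close>
  note d = std_bdry_mult[OF std_bdry_carrier(1) c] std_bdry_mult[OF one_carrier_mat c]
  have e: "std_bdry ps * ?I = std_bdry ps" by (rule right_mult_one_mat) (rule std_bdry_carrier(1))
  show "(std_bdry ps * std_bdry ps) $$ (r, c) = 0\<^sub>m (2 * length ps + 1) (2 * length ps + 1) $$ (r, c)"
    using r
  proof (cases rule: std_index_cases)
    case 1
    then show ?thesis using d(1) c by simp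
  next
    case (2 i)
    then show ?thesis using d(2)[of i] d(6)[of i] c r by (simp add: e)
  next
    case (3 i)
    then show ?thesis using d(3)[of i] d(5)[of i] c r by (simp add: e)
  qed
qed (simp_all add: std_bdry_def)

lemma std_omega_squared: "std_omega ps * std_omega ps = 0\<^sub>m (2 * length ps + 1) (2 * length ps + 1)"
proof (rule eq_matI)
  fix r c
  assume "r < dim_row (0\<^sub>m (2 * length ps + 1) (2 * length ps + 1))"
    and "c < dim_col (0\<^sub>m (2 * length ps + 1) (2 * length ps + 1))"
  then have r: "r < 2 * length ps + 1" and c: "c < 2 * length ps + 1" by simp_all
  let ?I = "1\<^sub>m (2 * length ps + 1) :: bit poly mat"
  note d = std_omega_mult[OF std_omega_carrier(1) c] std_omega_mult[OF one_carrier_mat c]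
  have e: "std_omega ps * ?I = std_omega ps" by (rule right_mult_one_mat) (rule std_omega_carrier(1))
  show "(std_omega ps * std_omega ps) $$ (r, c) = 0\<^sub>m (2 * length ps + 1) (2 * length ps + 1) $$ (r, c)"
  proof (cases "odd r")
    case True
    then obtain i where "r = 2 * i + 1" by (rule oddE)
    then show ?thesis using d(2)[of i] d(3)[of i] c r by (simp add: e)
  next
    case False
    then obtain i where "r = 2 * i" by (auto elim: evenE)
    then show ?thesis using d(1)[of i] d(4)[of i] c r by (simp add: e)
  qed
qed (simp_all add: std_omega_def)

lemma valid_params_nth: "valid_params ps \<Longrightarrow> i < length ps \<Longrightarrow> snd (ps ! i) \<noteq> 0"
  unfolding valid_params_def using nth_mem by fastforce

text \<open>
  Standard complexes are reduced: as no \<open>b\<^sub>i\<close> is zero, the differential vanishes modulo \<open>U\<close>.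
\<close>

lemma coeff_0_std_bdry:
  assumes "valid_params ps" "r < 2 * length ps + 1" "c < 2 * length ps + 1"
  shows "coeff (std_bdry ps $$ (r, c)) 0 = 0"
proof (rule ccontr)
  assume nz: "coeff (std_bdry ps $$ (r, c)) 0 \<noteq> 0"
  have U: "coeff (Uvar ^ nat \<bar>b\<bar>) 0 = 0" if "b \<noteq> 0" for b :: int
    using that coeff_Uvar_pow_mult[of "nat \<bar>b\<bar>" 1 0] by (auto split: if_splits)
  have v: "snd (ps ! i) \<noteq> 0" if "i < length ps" for i
    using assms(1) that by (rule valid_params_nth)
  have "std_bdry ps $$ (r, c) \<noteq> 0" using nz by auto
  then consider i where "r = 2 * i + 1" "c = 2 * i + 2" | i where "r = 2 * i + 2" "c = 2 * i + 1"
    using std_bdry_eq_0[OF assms(2,3)] by blast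
  then show False
  proof cases
    case (1 i)
    then have i: "i < length ps" using assms by simp
    show False using nz U[OF v[OF i]] unfolding 1 std_bdry_down[OF i] by (auto split: if_splits)
  next
    case (2 i)
    then have i: "i < length ps" using assms by simp
    show False using nz U[OF v[OF i]] unfolding 2 std_bdry_up[OF i] by (auto split: if_splits)
  qed
qed

lemma unit_vec_cycle_std: "unit_vec (2 * length ps + 1) 0 \<in> cycles (standard_complex ps)"
proof -
  let ?e = "unit_vec (2 * length ps + 1) 0 :: bit poly vec"
  have e: "?e \<in> carrier_vec (2 * length ps + 1)" by simp
  have "std_bdry ps *\<^sub>v ?e = 0\<^sub>v (2 * length ps + 1)"
  proof (rule eq_vecI)
    fix r assume "r < dim_vec (0\<^sub>v (2 * length ps + 1))"
    then have r: "r < 2 * length ps + 1" by simp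
    then show "(std_bdry ps *\<^sub>v ?e) $ r = 0\<^sub>v (2 * length ps + 1) $ r"
      by (cases rule: std_index_cases) (use std_bdry_mult_vec[OF e] in auto)
  qed (simp add: std_bdry_def)
  then show ?thesis by (simp add: cycles_def)
qed

text \<open>
  Reversing each \<open>\<partial>\<close>-arrow \<open>U\<^sup>|\<^sup>b\<^sup>|\<close> and giving it the weight \<open>U\<^sup>m\<^sup>-\<^sup>|\<^sup>b\<^sup>|\<close>, with \<open>m\<close> at least every \<open>|b|\<close>,
  contracts \<open>U\<^sup>m\<close> on the span of the pairs. For a cycle in this span the contraction produces a
  preimage of \<open>U\<^sup>m x\<close>.
\<close>

lemma std_torsion_cycle_boundary:
  assumes valid: "valid_params ps" and x: "x \<in> cycles (standard_complex ps)" and x0: "x $ 0 = 0"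
  shows "\<exists>m. Uvar ^ m \<cdot>\<^sub>v x \<in> boundaries (standard_complex ps)"
proof -
  let ?n = "2 * length ps + 1"
  define b where "b i = snd (ps ! i)" for i
  \<comment> \<open>The sum serves as a common upper bound of the exponents \<open>|b i|\<close>.\<close>
  define m where "m = (\<Sum>i < length ps. nat \<bar>b i\<bar>)"
  have m: "Uvar ^ nat \<bar>b i\<bar> * Uvar ^ (m - nat \<bar>b i\<bar>) = Uvar ^ m" if "i < length ps" for i
  proof -
    have "nat \<bar>b i\<bar> \<le> m" unfolding m_def using that by (intro member_le_sum) auto
    then show ?thesis by (simp flip: power_add)
  qed
  have b0: "b i \<noteq> 0" if "i < length ps" for i
    unfolding b_def using valid that by (rule valid_params_nth)
  have xc: "x \<in> carrier_vec ?n" and dx: "std_bdry ps *\<^sub>v x = 0\<^sub>v ?n"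
    using x by (auto simp: cycles_def)
  define y where "y = vec ?n (\<lambda>j.
     if j = 0 then 0
     else if even j then Uvar ^ (m - nat \<bar>b (j div 2 - 1)\<bar>) * x $ (j - 1)
     else Uvar ^ (m - nat \<bar>b (j div 2)\<bar>) * x $ (j + 1))"
  have yc: "y \<in> carrier_vec ?n" by (simp add: y_def)
  have yev: "y $ (2 * i + 2) = Uvar ^ (m - nat \<bar>b i\<bar>) * x $ (2 * i + 1)"
    and yod: "y $ (2 * i + 1) = Uvar ^ (m - nat \<bar>b i\<bar>) * x $ (2 * i + 2)"
    if "i < length ps" for i
    using that by (simp_all add: y_def)
  have "std_bdry ps *\<^sub>v y = Uvar ^ m \<cdot>\<^sub>v x"
  proof (rule eq_vecI)
    fix r assume "r < dim_vec (Uvar ^ m \<cdot>\<^sub>v x)"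
    then have r: "r < ?n" using xc by simp
    then show "(std_bdry ps *\<^sub>v y) $ r = (Uvar ^ m \<cdot>\<^sub>v x) $ r"
    proof (cases rule: std_index_cases)
      case 1
      then show ?thesis using std_bdry_mult_vec(1)[OF yc] xc x0 by simp
    next
      case (2 i)
      note i = \<open>i < length ps\<close>
      show ?thesis
      proof (cases "b i > 0")
        case True
        then have "(std_bdry ps *\<^sub>v y) $ (2 * i + 1) = Uvar ^ nat \<bar>b i\<bar> * Uvar ^ (m - nat \<bar>b i\<bar>) * x $ (2 * i + 1)"
          using std_bdry_mult_vec(2)[OF yc i] unfolding yev[OF i] b_def by simp
        then show ?thesis unfolding m[OF i] using 2 xc by simp
      next
        case False
        \<comment> \<open>The arrow leaves \<open>T\<^sub>2\<^sub>i\<^sub>+\<^sub>1\<close>, so the cycle \<open>x\<close> cannot involve it.\<close>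
        then have "x $ (2 * i + 1) = 0"
          using std_bdry_mult_vec(3)[OF xc i] b0[OF i] i unfolding dx b_def
          by (simp add: Uvar_def monom_power)
        then show ?thesis
          using std_bdry_mult_vec(2)[OF yc i] False 2 xc unfolding b_def by simp
      qed
    next
      case (3 i)
      note i = \<open>i < length ps\<close>
      show ?thesis
      proof (cases "b i < 0")
        case True
        then have "(std_bdry ps *\<^sub>v y) $ (2 * i + 2) = Uvar ^ nat \<bar>b i\<bar> * Uvar ^ (m - nat \<bar>b i\<bar>) * x $ (2 * i + 2)"
          using std_bdry_mult_vec(3)[OF yc i] unfolding yod[OF i] b_def by simp
        then show ?thesis unfolding m[OF i] using 3 xc by simp
      next
        case False
        then have "x $ (2 * i + 2) = 0"
          using std_bdry_mult_vec(2)[OF xc i] b0[OF i] i unfolding dx b_def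
          by (simp add: Uvar_def monom_power)
        then show ?thesis
          using std_bdry_mult_vec(3)[OF yc i] False 3 xc unfolding b_def by simp
      qed
    qed
  qed (use xc in \<open>simp add: std_bdry_def\<close>)
  then show ?thesis using yc by (auto simp: boundaries_def intro!: exI[of _ m] exI[of _ y])
qed

lemma tower_coordinate_std:
  assumes "valid_params ps"
  shows "tower_coordinate (standard_complex ps)"
  unfolding tower_coordinate_def
proof (intro conjI ballI)
  fix x assume x: "x \<in> cycles (standard_complex ps)"
  have "x $ 0 = 0" if b: "Uvar ^ m \<cdot>\<^sub>v x \<in> boundaries (standard_complex ps)" for m
  proof -
    obtain y where y: "y \<in> carrier_vec (2 * length ps + 1)" "Uvar ^ m \<cdot>\<^sub>v x = std_bdry ps *\<^sub>v y"
      using b by (auto simp: boundaries_def)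
    have "(Uvar ^ m \<cdot>\<^sub>v x) $ 0 = 0" unfolding y(2) by (rule std_bdry_mult_vec(1)[OF y(1)])
    then show ?thesis using cyclesD[OF x] by (simp add: Uvar_def monom_power)
  qed
  then show "x $ 0 = 0 \<longleftrightarrow> (\<exists>m. Uvar ^ m \<cdot>\<^sub>v x \<in> boundaries (standard_complex ps))"
    using std_torsion_cycle_boundary[OF assms x] by blast
qed (use unit_vec_cycle_std[of ps] in simp_all)

text \<open>
  Since \<open>\<omega>\<^sup>2 = 0\<close> and the characteristic is two, \<open>(1 + \<omega>)\<^sup>2 = 1\<close> holds exactly and the zero homotopy
  suffices; \<open>\<iota>\<partial> + \<partial>\<iota>\<close> lies in the image of \<open>U\<close> because \<open>\<partial>\<close> does.
\<close>

lemma almost_iota_complex_std: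
  assumes "valid_params ps"
  shows "almost_iota_complex (standard_complex ps)"
proof -
  let ?C = "standard_complex ps" let ?n = "2 * length ps + 1"
  let ?\<omega> = "std_omega ps" let ?d = "std_bdry ps" let ?I = "1\<^sub>m ?n :: bit poly mat"
  have inv: "?I + ?\<omega> \<in> graded_maps ?C ?C 0"
    using graded_maps_add[OF graded_maps_one[of ?C]] std_omega_graded by simp
  then have ic: "?I + ?\<omega> \<in> carrier_mat ?n ?n" by auto
  have "loc_homology_is_laurent ?C"
    by (intro loc_homology_is_laurent_tower tower_coordinate_std assms)
      (simp add: gr_standard_complex std_gr_def)
  moreover have "(?I + ?\<omega>) * ?d + ?d * (?I + ?\<omega>) \<in> im_U ?C ?C"
    unfolding im_U_iff
  proof (intro conjI allI impI)
    fix r c assume "r < rank ?C" "c < rank ?C"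
    then have rc: "r < ?n" "c < ?n" by simp_all
    have "coeff (((?I + ?\<omega>) * ?d) $$ (r, c)) 0 = 0"
      unfolding coeff_0_mult_mat[OF ic std_bdry_carrier(1) rc]
      using rc by (intro sum.neutral) (simp add: coeff_0_std_bdry[OF assms])
    moreover have "coeff ((?d * (?I + ?\<omega>)) $$ (r, c)) 0 = 0"
      unfolding coeff_0_mult_mat[OF std_bdry_carrier(1) ic rc]
      using rc by (intro sum.neutral) (simp add: coeff_0_std_bdry[OF assms])
    moreover have "((?I + ?\<omega>) * ?d + ?d * (?I + ?\<omega>)) $$ (r, c)
        = ((?I + ?\<omega>) * ?d) $$ (r, c) + (?d * (?I + ?\<omega>)) $$ (r, c)"
      using rc std_bdry_carrier[of ps] ic by (intro index_add_mat(1)) auto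
    ultimately show "coeff (((?I + ?\<omega>) * ?d + ?d * (?I + ?\<omega>)) $$ (r, c)) 0 = 0" by simp
  qed (use ic std_bdry_carrier[of ps] in auto)
  moreover have "homotopic_mod_U ?C ?C ((?I + ?\<omega>) * (?I + ?\<omega>)) ?I"
  proof -
    let ?Z = "0\<^sub>m ?n ?n :: bit poly mat"
    have "(?I + ?\<omega>) * (?I + ?\<omega>) = (?I + ?\<omega>) + (?I + ?\<omega>) * ?\<omega>"
      using ic by (subst mult_add_distrib_mat[of _ ?n ?n _ ?n]) auto
    also have "(?I + ?\<omega>) * ?\<omega> = ?\<omega> + ?\<omega> * ?\<omega>"
      by (subst add_mult_distrib_mat[of _ ?n ?n _ _ ?n]) auto
    finally have "(?I + ?\<omega>) * (?I + ?\<omega>) + ?I + ?Z * ?d + ?d * ?Z = ?Z"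
      unfolding std_omega_squared using std_omega_carrier[of ps] std_bdry_carrier[of ps]
      by (intro eq_matI) (auto simp: bit_poly_two)
    moreover have "?Z \<in> im_U ?C ?C" unfolding im_U_iff by simp
    moreover have "?Z \<in> graded_maps ?C ?C 1" using graded_maps_zero[of ?C] by simp
    ultimately show ?thesis unfolding homotopic_mod_U_def bdry_standard_complex by metis
  qed
  ultimately show ?thesis
    using std_bdry_graded[of ps] std_bdry_squared[of ps] inv by (simp add: almost_iota_complex_def)
qed


section \<open>Uniqueness of the standard representative\<close>

lemma grading_shift_simps [simp]:
  "rank (grading_shift s C) = rank C" "bdry (grading_shift s C) = bdry C"
  "inv\<iota> (grading_shift s C) = inv\<iota> C" "cycles (grading_shift s C) = cycles C"
  "boundaries (grading_shift s C) = boundaries C"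
  by (simp_all add: grading_shift_def rank_def cycles_def boundaries_def)

lemma gr_grading_shift: "i < rank C \<Longrightarrow> gr (grading_shift s C) ! i = gr C ! i + s"
  by (simp add: grading_shift_def rank_def)

lemma tower_coordinate_shift: "tower_coordinate C \<Longrightarrow> tower_coordinate (grading_shift s C)"
  unfolding tower_coordinate_def by simp

text \<open>
  What remains of a local map between reduced complexes once homotopies and gradings are forgotten:
  a chain map that commutes with \<open>\<omega>\<close> modulo \<open>U\<close>.
\<close>

definition omega_morphism :: "std_params \<Rightarrow> std_params \<Rightarrow> bit poly mat \<Rightarrow> bool" where
  "omega_morphism ps qs f \<longleftrightarrow>
     f \<in> carrier_mat (2 * length qs + 1) (2 * length ps + 1) \<and>
     f * std_bdry ps = std_bdry qs * f \<and>
     (\<forall>r < 2 * length qs + 1. \<forall>c < 2 * length ps + 1.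
        coeff ((f * std_omega ps) $$ (r, c)) 0 = coeff ((std_omega qs * f) $$ (r, c)) 0)"

text \<open>
  The terms \<open>H\<partial>\<close> and \<open>\<partial>H\<close> of the homotopy vanish modulo \<open>U\<close>, and the two contributions of the
  identity summand of \<open>\<iota> = 1 + \<omega>\<close> cancel.
\<close>

lemma omega_morphismI:
  assumes valid: "valid_params ps" "valid_params qs"
    and f: "local_map (grading_shift s (standard_complex ps)) (grading_shift t (standard_complex qs)) f"
  shows "omega_morphism ps qs f"
  unfolding omega_morphism_def
proof (intro conjI allI impI)
  let ?C = "grading_shift s (standard_complex ps)" let ?D = "grading_shift t (standard_complex qs)"
  let ?n = "2 * length ps + 1" let ?m = "2 * length qs + 1"
  show fc: "f \<in> carrier_mat ?m ?n"
    using f graded_mapsD[of f ?C ?D 0] by (simp add: local_map_def)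
  show "f * std_bdry ps = std_bdry qs * f" using f by (simp add: local_map_def)
  have "homotopic_mod_U ?C ?D (f * (1\<^sub>m ?n + std_omega ps)) ((1\<^sub>m ?m + std_omega qs) * f)"
    using f by (simp add: local_map_def)
  then obtain H where H: "H \<in> graded_maps ?C ?D 1"
    and im: "f * (1\<^sub>m ?n + std_omega ps) + (1\<^sub>m ?m + std_omega qs) * f
        + H * std_bdry ps + std_bdry qs * H \<in> im_U ?C ?D" (is "?M \<in> _")
    unfolding homotopic_mod_U_def by auto
  have Hc: "H \<in> carrier_mat ?m ?n" using graded_mapsD[OF H] by simp
  fix r c assume r: "r < ?m" and c: "c < ?n"
  have e1: "f * (1\<^sub>m ?n + std_omega ps) = f + f * std_omega ps"
    using fc by (subst mult_add_distrib_mat[of _ ?m ?n _ ?n]) auto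
  have e2: "(1\<^sub>m ?m + std_omega qs) * f = f + std_omega qs * f"
    using fc by (subst add_mult_distrib_mat[of _ ?m ?m _ _ ?n]) auto
  have "?M $$ (r, c) = (f * std_omega ps) $$ (r, c) + (std_omega qs * f) $$ (r, c)
      + (H * std_bdry ps) $$ (r, c) + (std_bdry qs * H) $$ (r, c) + (f $$ (r, c) + f $$ (r, c))"
    unfolding e1 e2 using fc Hc r c by (simp add: algebra_simps del: index_mult_mat(1))
  moreover have "coeff ((H * std_bdry ps) $$ (r, c)) 0 = 0"
    unfolding coeff_0_mult_mat[OF Hc std_bdry_carrier(1) r c]
    using c by (intro sum.neutral) (simp add: coeff_0_std_bdry[OF valid(1)])
  moreover have "coeff ((std_bdry qs * H) $$ (r, c)) 0 = 0"
    unfolding coeff_0_mult_mat[OF std_bdry_carrier(1) Hc r c]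
    using r by (intro sum.neutral) (simp add: coeff_0_std_bdry[OF valid(2)])
  moreover have "coeff (?M $$ (r, c)) 0 = 0" using im r c by (simp add: im_U_iff)
  ultimately have "coeff ((f * std_omega ps) $$ (r, c)) 0 + coeff ((std_omega qs * f) $$ (r, c)) 0 = 0"
    unfolding bit_poly_add_self by (simp only: coeff_add coeff_0 add_0_right)
  then show "coeff ((f * std_omega ps) $$ (r, c)) 0 = coeff ((std_omega qs * f) $$ (r, c)) 0"
    by (cases "coeff ((f * std_omega ps) $$ (r, c)) 0";
        cases "coeff ((std_omega qs * f) $$ (r, c)) 0") simp_all
qed

text \<open>
  Otherwise \<open>f\<close> would send the tower generator to a cycle without tower coordinate, which represents
  zero after localization, against injectivity.
\<close>

lemma tower_entry_nonzero:
  assumes C: "tower_coordinate C" and D: "tower_coordinate D" and f: "local_map C D f"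
  shows "f $$ (0, 0) \<noteq> 0"
proof
  assume z: "f $$ (0, 0) = 0"
  have r: "rank C > 0" "rank D > 0"
    and c: "bdry C \<in> carrier_mat (rank C) (rank C)" "bdry D \<in> carrier_mat (rank D) (rank D)"
    and e: "unit_vec (rank C) 0 \<in> cycles C"
    using C D unfolding tower_coordinate_def by blast+
  let ?e = "unit_vec (rank C) 0 :: bit poly vec"
  have fc: "f \<in> carrier_mat (rank D) (rank C)" and ch: "f * bdry C = bdry D * f"
    and bij: "bij_betw (loc_map D f) (loc_homology C) (loc_homology D)"
    using f graded_mapsD by (auto simp: local_map_def)
  have zero: "0\<^sub>v (rank C) \<in> cycles C" using c(1) by (auto simp: cycles_def)
  have "(f *\<^sub>v ?e) $ 0 = (f *\<^sub>v 0\<^sub>v (rank C)) $ 0"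
    using z fc r by simp
  then have "loc_frac D (f *\<^sub>v ?e) 0 = loc_frac D (f *\<^sub>v 0\<^sub>v (rank C)) 0"
    using loc_frac_tower[OF D chain_map_cycle[OF c fc ch e] chain_map_cycle[OF c fc ch zero]] by simp
  then have "loc_map D f (loc_frac C ?e 0) = loc_map D f (loc_frac C (0\<^sub>v (rank C)) 0)"
    using loc_map_frac[OF c fc ch e] loc_map_frac[OF c fc ch zero] by simp
  moreover have "loc_frac C ?e 0 \<in> loc_homology C" "loc_frac C (0\<^sub>v (rank C)) 0 \<in> loc_homology C"
    unfolding loc_homology_def loc_frac_def using e zero by (auto intro: quotientI)
  ultimately have "loc_frac C ?e 0 = loc_frac C (0\<^sub>v (rank C)) 0"
    using bij by (auto simp: bij_betw_def dest: inj_onD)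
  then have "laurent_frac (?e $ 0) 0 = laurent_frac (0\<^sub>v (rank C) $ 0) 0"
    using loc_frac_tower[OF C e zero] by simp
  then show False using laurent_frac_inj r(1) by fastforce
qed

text \<open>
  Local maps preserve the grading, so the tower of the target starts at least as high as that of
  the source, and the two shifts differ by \<open>2k\<close> for a power \<open>U\<^sup>k\<close> that occurs in the entry.
\<close>

lemma tower_entry_degree:
  assumes valid: "valid_params ps" "valid_params qs"
    and f: "local_map (grading_shift s (standard_complex ps)) (grading_shift t (standard_complex qs)) f"
  obtains k where "coeff (f $$ (0, 0)) k \<noteq> 0" "t = s + 2 * int k"
proof -
  have "f $$ (0, 0) \<noteq> 0"
    using tower_entry_nonzero[OF tower_coordinate_shift tower_coordinate_shift f]
      tower_coordinate_std valid by blast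
  then obtain k where k: "coeff (f $$ (0, 0)) k \<noteq> 0" by (metis leading_coeff_0_iff)
  have g: "f \<in> graded_maps (grading_shift s (standard_complex ps)) (grading_shift t (standard_complex qs)) 0"
    using f by (simp add: local_map_def)
  have "t - 2 * int k = s"
    using graded_maps_entry[OF g _ _ k]
    by (simp add: gr_grading_shift gr_standard_complex std_gr_def)
  then show ?thesis using that k by simp
qed

abbreviation unit_at :: "bit poly mat \<Rightarrow> nat \<Rightarrow> bool" where
  "unit_at f i \<equiv> coeff (f $$ (i, i)) 0 \<noteq> 0"

text \<open>
  Since \<open>\<omega> T\<^sub>2\<^sub>i\<^sub>+\<^sub>1 = T\<^sub>2\<^sub>i\<close> in the source, modulo \<open>U\<close> the element \<open>f T\<^sub>2\<^sub>i\<close> is \<open>\<omega> f T\<^sub>2\<^sub>i\<^sub>+\<^sub>1\<close>. It involves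
  \<open>T\<^sub>2\<^sub>i\<close>, so an \<open>\<omega>\<close>-arrow of the target must end there, and it can only start at \<open>T\<^sub>2\<^sub>i\<^sub>+\<^sub>1\<close>.
\<close>

lemma omega_step_Plus:
  assumes f: "omega_morphism ps qs f" and u: "unit_at f (2 * i)"
    and i: "i < length ps" "i \<le> length qs" and a: "fst (ps ! i) = Plus"
  shows "i < length qs \<and> fst (qs ! i) = Plus \<and> unit_at f (2 * i + 1)"
proof -
  have fc: "f \<in> carrier_mat (2 * length qs + 1) (2 * length ps + 1)"
    using f by (simp add: omega_morphism_def)
  have r: "2 * i < 2 * length qs + 1" and c: "2 * i + 1 < 2 * length ps + 1" using i by simp_all
  have "coeff ((f * std_omega ps) $$ (2 * i, 2 * i + 1)) 0 = coeff ((std_omega qs * f) $$ (2 * i, 2 * i + 1)) 0"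
    using f r c unfolding omega_morphism_def by blast
  then show ?thesis
    unfolding mult_std_omega(1)[OF fc r i(1)] std_omega_mult(1)[OF fc c i(2)]
    using u a by (auto split: if_splits)
qed

text \<open>
  In the target \<open>\<omega> T\<^sub>2\<^sub>i = T\<^sub>2\<^sub>i\<^sub>+\<^sub>1\<close>, so \<open>\<omega> f T\<^sub>2\<^sub>i\<close> is nonzero modulo \<open>U\<close> and hence so is \<open>f \<omega> T\<^sub>2\<^sub>i\<close>; in the
  source an \<open>\<omega>\<close>-arrow must leave \<open>T\<^sub>2\<^sub>i\<close>. The list of the source cannot have ended, although
  \<open>i = length ps\<close> is admitted.
\<close>

lemma omega_step_Minus:
  assumes f: "omega_morphism ps qs f" and u: "unit_at f (2 * i)"
    and i: "i \<le> length ps" "i < length qs" and a: "fst (qs ! i) = Minus"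
  shows "i < length ps \<and> fst (ps ! i) = Minus \<and> unit_at f (2 * i + 1)"
proof -
  have fc: "f \<in> carrier_mat (2 * length qs + 1) (2 * length ps + 1)"
    using f by (simp add: omega_morphism_def)
  have r: "2 * i + 1 < 2 * length qs + 1" and c: "2 * i < 2 * length ps + 1" using i by simp_all
  have "coeff ((f * std_omega ps) $$ (2 * i + 1, 2 * i)) 0 = coeff ((std_omega qs * f) $$ (2 * i + 1, 2 * i)) 0"
    using f r c unfolding omega_morphism_def by blast
  then show ?thesis
    unfolding mult_std_omega(2)[OF fc r i(1)] std_omega_mult(2)[OF fc c i(2)]
    using u a by (auto split: if_splits)
qed

text \<open>
  The element \<open>\<partial> f T\<^sub>2\<^sub>i\<^sub>+\<^sub>2 = U\<^sup>b f T\<^sub>2\<^sub>i\<^sub>+\<^sub>1\<close> has the coefficient \<open>U\<^sup>b\<close> at \<open>T\<^sub>2\<^sub>i\<^sub>+\<^sub>1\<close>, up to higher powers of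
  \<open>U\<close>. So an arrow of the target ends at \<open>T\<^sub>2\<^sub>i\<^sub>+\<^sub>1\<close>, with an exponent \<open>b' \<le> b\<close>; the entry of \<open>f\<close> at \<open>T\<^sub>2\<^sub>i\<^sub>+\<^sub>2\<close>
  makes up for the missing power of \<open>U\<close>, with exponent \<open>b - b'\<close>.
\<close>

lemma bdry_step_pos:
  assumes f: "omega_morphism ps qs f" and u: "unit_at f (2 * i + 1)"
    and i: "i < length ps" "i < length qs" and b: "snd (ps ! i) > 0"
  shows "0 < snd (qs ! i) \<and> snd (qs ! i) \<le> snd (ps ! i) \<and>
    (snd (qs ! i) = snd (ps ! i) \<longrightarrow> unit_at f (2 * i + 2))"
proof -
  have fc: "f \<in> carrier_mat (2 * length qs + 1) (2 * length ps + 1)"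
    and ch: "f * std_bdry ps = std_bdry qs * f"
    using f by (simp_all add: omega_morphism_def)
  have r: "2 * i + 1 < 2 * length qs + 1" and c: "2 * i + 2 < 2 * length ps + 1" using i by simp_all
  let ?m = "nat \<bar>snd (ps ! i)\<bar>" let ?n = "nat \<bar>snd (qs ! i)\<bar>"
  have "Uvar ^ ?m * f $$ (2 * i + 1, 2 * i + 1) =
      (if snd (qs ! i) > 0 then Uvar ^ ?n * f $$ (2 * i + 2, 2 * i + 2) else 0)"
    using mult_std_bdry(2)[OF fc r i(1)] b
    unfolding ch std_bdry_mult(2)[OF fc c i(2)] by (simp add: mult.commute)
  then have "coeff (Uvar ^ ?m * f $$ (2 * i + 1, 2 * i + 1)) ?m =
      coeff (if snd (qs ! i) > 0 then Uvar ^ ?n * f $$ (2 * i + 2, 2 * i + 2) else 0) ?m"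
    by (rule arg_cong)
  then show ?thesis
    using u b by (auto simp: coeff_Uvar_pow_mult split: if_splits)
qed

text \<open>
  The mirror image: the coefficient of \<open>\<partial> f T\<^sub>2\<^sub>i\<^sub>+\<^sub>1\<close> at \<open>T\<^sub>2\<^sub>i\<^sub>+\<^sub>2\<close> is nonzero, so an arrow of the source
  leaves \<open>T\<^sub>2\<^sub>i\<^sub>+\<^sub>1\<close>, and its exponent is at most that of the target.
\<close>

lemma bdry_step_neg:
  assumes f: "omega_morphism ps qs f" and u: "unit_at f (2 * i + 1)"
    and i: "i < length ps" "i < length qs" and b: "snd (qs ! i) < 0"
  shows "snd (ps ! i) < 0 \<and> snd (qs ! i) \<le> snd (ps ! i) \<and>
    (snd (qs ! i) = snd (ps ! i) \<longrightarrow> unit_at f (2 * i + 2))"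
proof -
  have fc: "f \<in> carrier_mat (2 * length qs + 1) (2 * length ps + 1)"
    and ch: "f * std_bdry ps = std_bdry qs * f"
    using f by (simp_all add: omega_morphism_def)
  have r: "2 * i + 2 < 2 * length qs + 1" and c: "2 * i + 1 < 2 * length ps + 1" using i by simp_all
  let ?m = "nat \<bar>snd (ps ! i)\<bar>" let ?n = "nat \<bar>snd (qs ! i)\<bar>"
  have "Uvar ^ ?n * f $$ (2 * i + 1, 2 * i + 1) =
      (if snd (ps ! i) < 0 then Uvar ^ ?m * f $$ (2 * i + 2, 2 * i + 2) else 0)"
    using mult_std_bdry(1)[OF fc r i(1)] b
    unfolding ch std_bdry_mult(3)[OF fc c i(2)] by (simp add: mult.commute)
  then have "coeff (Uvar ^ ?n * f $$ (2 * i + 1, 2 * i + 1)) ?n =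
      coeff (if snd (ps ! i) < 0 then Uvar ^ ?m * f $$ (2 * i + 2, 2 * i + 2) else 0) ?n"
    by (rule arg_cong)
  then show ?thesis
    using u b by (auto simp: coeff_Uvar_pow_mult split: if_splits)
qed

text \<open>
  One map gives one inequality for the next parameters, the other map the reverse inequality. Only
  together do they also keep both diagonal entries units modulo \<open>U\<close>, so both maps must be carried
  through the induction.
\<close>

lemma omega_morphisms_step:
  assumes f: "omega_morphism ps qs f" "unit_at f (2 * i)"
    and g: "omega_morphism qs ps g" "unit_at g (2 * i)"
    and v: "valid_params ps" and i: "i < length ps" "i \<le> length qs"
  shows "i < length qs \<and> qs ! i = ps ! i \<and> unit_at f (2 * Suc i) \<and> unit_at g (2 * Suc i)"
proof -
  have a: "i < length qs \<and> fst (qs ! i) = fst (ps ! i) \<and> unit_at f (2 * i + 1) \<and> unit_at g (2 * i + 1)"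
  proof (cases "fst (ps ! i)")
    case Plus
    have 1: "i < length qs \<and> fst (qs ! i) = Plus \<and> unit_at f (2 * i + 1)"
      by (rule omega_step_Plus[OF f i Plus])
    then have "unit_at g (2 * i + 1)"
      using omega_step_Plus[OF g _ less_imp_le] i by blast
    then show ?thesis using 1 Plus by simp
  next
    case Minus
    have 1: "i < length qs \<and> fst (qs ! i) = Minus \<and> unit_at g (2 * i + 1)"
      by (rule omega_step_Minus[OF g i(2,1) Minus])
    then have "unit_at f (2 * i + 1)"
      using omega_step_Minus[OF f less_imp_le] i by blast
    then show ?thesis using 1 Minus by simp
  qed
  then have iq: "i < length qs" and uf: "unit_at f (2 * i + 1)" and ug: "unit_at g (2 * i + 1)" by auto
  have b: "snd (qs ! i) = snd (ps ! i) \<and> unit_at f (2 * i + 2) \<and> unit_at g (2 * i + 2)"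
  proof (cases "snd (ps ! i) > 0")
    case True
    then show ?thesis
      using bdry_step_pos[OF f(1) uf i(1) iq] bdry_step_pos[OF g(1) ug iq i(1)] by force
  next
    case False
    then have "snd (ps ! i) < 0" using valid_params_nth[OF v i(1)] by simp
    then show ?thesis
      using bdry_step_neg[OF f(1) uf i(1) iq] bdry_step_neg[OF g(1) ug iq i(1)] by force
  qed
  show ?thesis using a b by (auto intro: prod_eqI)
qed

lemma omega_morphisms_prefix:
  assumes f: "omega_morphism ps qs f" "unit_at f 0"
    and g: "omega_morphism qs ps g" "unit_at g 0" and v: "valid_params ps"
  shows "i \<le> length ps \<Longrightarrow>
    i \<le> length qs \<and> take i qs = take i ps \<and> unit_at f (2 * i) \<and> unit_at g (2 * i)"
proof (induction i)
  case 0
  then show ?case using f g by simp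
next
  case (Suc i)
  then have i: "i < length ps" "i \<le> length qs"
    and IH: "take i qs = take i ps" "unit_at f (2 * i)" "unit_at g (2 * i)" by auto
  from omega_morphisms_step[OF f(1) IH(2) g(1) IH(3) v i] show ?case
    using IH(1) i(1) by (auto simp: take_Suc_conv_app_nth)
qed

text \<open>
  The entry of \<open>f\<close> from tower to tower gives \<open>s \<le> t\<close> and that of \<open>g\<close> gives \<open>t \<le> s\<close>; with equal
  shifts the power of \<open>U\<close> that occurs in these entries is \<open>U\<^sup>0\<close>, which starts the induction.
\<close>

lemma std_params_unique:
  assumes valid: "valid_params ps" "valid_params qs"
    and eq: "locally_equivalent (grading_shift s (standard_complex ps)) (grading_shift t (standard_complex qs))"
  shows "ps = qs"
proof -
  obtain f g
    where f: "local_map (grading_shift s (standard_complex ps)) (grading_shift t (standard_complex qs)) f"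
      and g: "local_map (grading_shift t (standard_complex qs)) (grading_shift s (standard_complex ps)) g"
    using eq unfolding locally_equivalent_def by blast
  obtain k where k: "coeff (f $$ (0, 0)) k \<noteq> 0" "t = s + 2 * int k"
    using tower_entry_degree[OF valid f] .
  obtain l where l: "coeff (g $$ (0, 0)) l \<noteq> 0" "s = t + 2 * int l"
    using tower_entry_degree[OF valid(2,1) g] .
  have kl: "k = 0" "l = 0" using k(2) l(2) by linarith+
  have u: "unit_at f 0" "unit_at g 0" using k(1) l(1) unfolding kl .
  note fm = omega_morphismI[OF valid f] and gm = omega_morphismI[OF valid(2,1) g]
  have "length ps \<le> length qs \<and> take (length ps) qs = ps"
    using omega_morphisms_prefix[OF fm u(1) gm u(2) valid(1), of "length ps"] by simp
  then have "length ps \<le> length qs" "take (length ps) qs = ps" by blast+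
  moreover have "length qs \<le> length ps"
    using omega_morphisms_prefix[OF gm u(2) fm u(1) valid(2), of "length qs"] by simp
  ultimately show ?thesis by (metis take_all)
qed

lemma grading_shift_0 [simp]: "grading_shift 0 C = C"
  by (cases C) (simp add: grading_shift_def)

lemma std_rep_standard:
  assumes "valid_params ps"
  shows "std_rep (abs_local_class (standard_complex ps)) = ps"
  unfolding std_rep_def
proof (rule the_equality)
  let ?C = "standard_complex ps"
  have refl: "iota_equiv ?C ?C" by (intro iota_equiv_refl almost_iota_complex_std assms)
  then show "standard_representative (abs_local_class ?C) ps"
    unfolding standard_representative_def using assms
    by (intro conjI exI[of _ ?C] exI[of _ 0]) simp_all
  fix qs assume "standard_representative (abs_local_class ?C) qs"
  then obtain D t where qs: "valid_params qs" and abs: "abs_local_class ?C = abs_local_class D"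
    and D: "iota_equiv D (grading_shift t (standard_complex qs))"
    unfolding standard_representative_def by blast
  have "iota_equiv D D" using iota_equiv_trans[OF D iota_equiv_sym[OF D]] .
  then have "iota_equiv ?C D"
    using Quotient3_rel[OF Quotient3_local_class, of ?C D] refl abs by simp
  then have "iota_equiv (grading_shift 0 ?C) (grading_shift t (standard_complex qs))"
    using iota_equiv_trans[OF _ D] by simp
  then have "locally_equivalent (grading_shift 0 ?C) (grading_shift t (standard_complex qs))"
    by (simp only: iota_equiv_def)
  then show "qs = ps" by (rule std_params_unique[OF assms qs, symmetric])
qed


section \<open>The invariants on standard classes\<close>

text \<open>
  Every list position \<open>j\<close> is represented by the odd index \<open>2j + 1\<close> for its sign and by the even index
  \<open>2j + 2\<close> for its exponent.
\<close>

lemma card_a_par: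
  "card {i \<in> {1..2 * length ps}. odd i \<and> a_par ps i = a} = length (filter (\<lambda>p. fst p = a) ps)"
proof -
  have "bij_betw (\<lambda>j. 2 * j + 1) {j. j < length ps \<and> fst (ps ! j) = a}
      {i \<in> {1..2 * length ps}. odd i \<and> a_par ps i = a}"
    by (rule bij_betwI[of _ _ _ "\<lambda>i. i div 2"]) (auto simp: a_par_def elim!: oddE)
  then show ?thesis by (simp add: bij_betw_same_card length_filter_conv_card)
qed

lemma card_b_par:
  "card {i \<in> {1..2 * length ps}. even i \<and> b_par ps i = b} = length (filter (\<lambda>p. snd p = b) ps)"
proof -
  have "bij_betw (\<lambda>j. 2 * j + 2) {j. j < length ps \<and> snd (ps ! j) = b}
      {i \<in> {1..2 * length ps}. even i \<and> b_par ps i = b}"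
    by (rule bij_betwI[of _ _ _ "\<lambda>i. i div 2 - 1"]) (auto simp: b_par_def elim!: evenE)
  then show ?thesis by (simp add: bij_betw_same_card length_filter_conv_card)
qed

abbreviation std_class :: "std_params \<Rightarrow> local_class" where
  "std_class ps \<equiv> abs_local_class (standard_complex ps)"

lemma P_omega_std_class:
  "valid_params ps \<Longrightarrow> P_omega (std_class ps) =
     int (length (filter (\<lambda>p. fst p = Plus) ps)) - int (length (filter (\<lambda>p. fst p = Minus) ps))"
  unfolding P_omega_def by (simp only: std_rep_standard card_a_par Let_def)

lemma phi_std_class:
  "valid_params ps \<Longrightarrow> phi m (std_class ps) =
     int (length (filter (\<lambda>p. snd p = int m) ps)) - int (length (filter (\<lambda>p. snd p = - int m) ps))"
  unfolding phi_def by (simp only: std_rep_standard card_b_par Let_def)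

lemma surj_P_omega: "surj P_omega"
proof (rule surjI)
  fix n :: int
  define ps where "ps = replicate (nat \<bar>n\<bar>) (if n > 0 then Plus else Minus, 1 :: int)"
  have "valid_params ps" by (auto simp: valid_params_def ps_def)
  then show "P_omega (std_class (replicate (nat \<bar>n\<bar>) (if n > 0 then Plus else Minus, 1))) = n"
    unfolding ps_def[symmetric] P_omega_std_class[OF \<open>valid_params ps\<close>] by (simp add: ps_def)
qed

text \<open>
  Negating all exponents \<open>b\<^sub>i\<close> and keeping the signs \<open>a\<^sub>i\<close> negates each \<open>\<phi>\<^sub>m\<close>, and the two complexes are
  related in this way; the relation is linear, so it passes to the span.
\<close>

lemma phi_span_cancels:
  assumes "F \<in> int_fun.span (phi ` {1..})"
  shows "F (std_class [(Plus, 1)]) + F (std_class [(Plus, - 1)]) = 0"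
  using assms
proof (induction rule: int_fun.span_induct_alt)
  case base
  then show ?case by simp
next
  case (step c F G)
  have valid: "valid_params [(Plus, 1)]" "valid_params [(Plus, - 1)]" by (simp_all add: valid_params_def)
  obtain m where "F = phi m" "m \<ge> 1" using step(1) by auto
  then have "F (std_class [(Plus, 1)]) + F (std_class [(Plus, - 1)]) = 0"
    by (simp add: phi_std_class[OF valid(1)] phi_std_class[OF valid(2)])
  then have "c * (F (std_class [(Plus, 1)]) + F (std_class [(Plus, - 1)])) +
      (G (std_class [(Plus, 1)]) + G (std_class [(Plus, - 1)])) = 0"
    using step(2) by simp
  then show ?case by (simp add: algebra_simps)
qed

theorem theorem1p6:
  shows "surj P_omega \<and> P_omega \<notin> int_fun.span (phi ` {1..})"
proof
  show "surj P_omega" by (rule surj_P_omega)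
  have valid: "valid_params [(Plus, 1)]" "valid_params [(Plus, - 1)]" by (simp_all add: valid_params_def)
  have "P_omega (std_class [(Plus, 1)]) + P_omega (std_class [(Plus, - 1)]) \<noteq> 0"
    by (simp add: P_omega_std_class[OF valid(1)] P_omega_std_class[OF valid(2)])
  then show "P_omega \<notin> int_fun.span (phi ` {1..})" using phi_span_cancels by blast
qed

end
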